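(* Let $k$ be a field, let $H$ be an irreducible affine algebraic group scheme over $k$ and let $A$ be a $\mathrm{Dist}(H)$-algebra. Assume that $A$ is a unique factorisation domain. Then the (multiplicative) monoid of nonzero elements $a\in A$ such that the ideal $Aa$ is $\mathrm{Dist}(H)$-stable has the unique factorisation property. If $\mathrm{char}\,k=0$, then its irreducible elements are the irreducible elements $a$ of $A$ such that $Aa$ is $\mathrm{Lie}(H)$-stable. If $\mathrm{char}\,k=p>0$, then its irreducible elements are the elements $a^{p^s}$, where $a$ is irreducible in $A$, $s\ge 0$, $Aa^{p^s}$ is $\mathrm{Dist}(H)$-stable, and $s$ is minimal with this property.
   Context: For an affine algebraic group scheme $H$ over $k$ with identity $e\in H(k)$, let $I_e\subseteq k[H]$ be the vanishing ideal of $e$. $\mathrm{Dist}(H)\subseteq k[H]^*$ is the space of linear functionals on $k[H]$ vanishing on some power of $I_e$ (distributions supported at $e$). It is a Hopf algebra: the product is dual to the comultiplication of $k[H]$, the unit is evaluation at $e$, the comultiplication is $\Delta(u)(f\otimes g)=u(fg)$, and the counit is $u\mapsto u(1)$. The Lie algebra $\mathrm{Lie}(H)\subseteq\mathrm{Dist}(H)$ consists of the functionals vanishing on $I_e^2$ and on $1$. Using the comultiplication, tensor products of $\mathrm{Dist}(H)$-modules are $\mathrm{Dist}(H)$-modules. A $k$-algebra $A$ is a $\mathrm{Dist}(H)$-algebra if it is a $\mathrm{Dist}(H)$-module such that the multiplication $A\otimes A\to A$ is a morphism of $\mathrm{Dist}(H)$-modules. A commutative monoid in which the cancellation law holds has the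 unique factorisation property if and only if its quotient by its group of units is a free commutative monoid.
   Formalization: In characteristic p the irreducible elements are described up to units, as u·a^{p^s} with u a unit of A; the literal equality with the elements a^{p^s} fails, e.g. for u·x^p in k[x] under translation by α_p with u in k not a p-th power. *)

theory Defs
  imports
    "HOL-Algebra.Divisibility"
    "HOL-Computational_Algebra.Computational_Algebra"
    "HOL-Library.Poly_Mapping"
begin

section \<open>Commutative algebras over a field\<close>

locale comm_algebra = vector_space scale
  for scale :: "'k::field \<Rightarrow> 'a::comm_ring_1 \<Rightarrow> 'a" +
  assumes scale_mult_left: "scale c (x * y) = scale c x * y"

definition subalgebra :: "('k::field \<Rightarrow> 'a::comm_ring_1 \<Rightarrow> 'a) \<Rightarrow> 'a set \<Rightarrow> bool" where
  "subalgebra scale B \<longleftrightarrow>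
     module.subspace scale B \<and> 1 \<in> B \<and> (\<forall>x\<in>B. \<forall>y\<in>B. x * y \<in> B)"

definition finitely_generated_algebra :: "('k::field \<Rightarrow> 'a::comm_ring_1 \<Rightarrow> 'a) \<Rightarrow> bool" where
  "finitely_generated_algebra scale \<longleftrightarrow>
     (\<exists>S. finite S \<and> (\<forall>B. subalgebra scale B \<and> S \<subseteq> B \<longrightarrow> B = UNIV))"

definition algebra_hom ::
    "('k::field \<Rightarrow> 'a::comm_ring_1 \<Rightarrow> 'a) \<Rightarrow> ('k \<Rightarrow> 'b::comm_ring_1 \<Rightarrow> 'b) \<Rightarrow> ('a \<Rightarrow> 'b) \<Rightarrow> bool" where
  "algebra_hom s1 s2 f \<longleftrightarrow>
     Vector_Spaces.linear s1 s2 f \<and> f 1 = 1 \<and> (\<forall>x y. f (x * y) = f x * f y)"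


section \<open>Ideals and the Zariski topology on the spectrum\<close>

text \<open>A ring is a module over itself, and its ideals are the submodules.\<close>

abbreviation is_ideal :: "'a::comm_ring_1 set \<Rightarrow> bool" where
  "is_ideal I \<equiv> module.subspace (*) I"

abbreviation ideal_generated :: "'a::comm_ring_1 set \<Rightarrow> 'a set" where
  "ideal_generated S \<equiv> module.span (*) S"

fun ideal_power :: "'a::comm_ring_1 set \<Rightarrow> nat \<Rightarrow> 'a set" where
  "ideal_power I 0 = UNIV"
| "ideal_power I (Suc n) = ideal_generated {x * y | x y. x \<in> I \<and> y \<in> ideal_power I n}"

definition principal_ideal :: "'a::comm_ring_1 \<Rightarrow> 'a set" where
  "principal_ideal a = range (\<lambda>b. b * a)"

definition spectrum :: "'a::comm_ring_1 set set" where
  "spectrum = {P. is_ideal P \<and> P \<noteq> UNIV \<and> (\<forall>x y. x * y \<in> P \<longrightarrow> x \<in> P \<or> y \<in> P)}"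

definition zariski_closed :: "'a::comm_ring_1 set set \<Rightarrow> bool" where
  "zariski_closed Z \<longleftrightarrow> (\<exists>S. Z = {P \<in> spectrum. S \<subseteq> P})"

definition irreducible_spectrum :: "'a::comm_ring_1 itself \<Rightarrow> bool" where
  "irreducible_spectrum _ \<longleftrightarrow>
     (spectrum :: 'a set set) \<noteq> {} \<and>
     (\<forall>Y Z :: 'a set set. zariski_closed Y \<and> zariski_closed Z \<and> Y \<union> Z = spectrum
        \<longrightarrow> Y = spectrum \<or> Z = spectrum)"


section \<open>Tensors as formal linear combinations\<close>

text \<open>
  A formal linear combination of pairs \<open>(a, b)\<close> represents a tensor in \<open>V \<otimes> W\<close>, with \<open>(a, b)\<close>
  standing for \<open>a \<otimes> b\<close>; similarly for triples. Two combinations represent the same tensor iff their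
  difference lies in the span of the multilinearity relations. A \<^emph>\<open>slot\<close> is a map
  inserting a vector at one position of a pure tensor whose other entries are fixed.
\<close>

definition formal_scale :: "'k::field \<Rightarrow> ('b \<Rightarrow>\<^sub>0 'k) \<Rightarrow> ('b \<Rightarrow>\<^sub>0 'k)" where
  "formal_scale c = Poly_Mapping.map ((*) c)"

definition linear_extension ::
    "('k::field \<Rightarrow> 'v::ab_group_add \<Rightarrow> 'v) \<Rightarrow> ('b \<Rightarrow> 'v) \<Rightarrow> ('b \<Rightarrow>\<^sub>0 'k) \<Rightarrow> 'v" where
  "linear_extension scale g t = (\<Sum>b\<in>Poly_Mapping.keys t. scale (Poly_Mapping.lookup t b) (g b))"

lemma lookup_formal_scale [simp]:
  "Poly_Mapping.lookup (formal_scale c t) b = c * Poly_Mapping.lookup t b"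
  by (simp add: formal_scale_def Poly_Mapping.map.rep_eq when_def)

interpretation formal: vector_space formal_scale
  by unfold_locales (auto intro!: poly_mapping_eqI simp: lookup_add algebra_simps)

definition multilinearity_relations ::
    "('k::field \<Rightarrow> 'v::ab_group_add \<Rightarrow> 'v) \<Rightarrow> ('v \<Rightarrow> 'b) set \<Rightarrow> ('b \<Rightarrow>\<^sub>0 'k) set" where
  "multilinearity_relations scale slots =
     {Poly_Mapping.single (m (x + y)) 1 - Poly_Mapping.single (m x) 1 - Poly_Mapping.single (m y) 1
        | m x y. m \<in> slots} \<union>
     {Poly_Mapping.single (m (scale c x)) 1 - Poly_Mapping.single (m x) c | m c x. m \<in> slots}"

definition tensor2_eq ::
    "('k::field \<Rightarrow> 'v::ab_group_add \<Rightarrow> 'v) \<Rightarrow> ('v \<times> 'v \<Rightarrow>\<^sub>0 'k) \<Rightarrow> ('v \<times> 'v \<Rightarrow>\<^sub>0 'k) \<Rightarrow> bool" where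
  "tensor2_eq scale s t \<longleftrightarrow>
     s - t \<in> module.span formal_scale (multilinearity_relations scale
       (range (\<lambda>b x. (x, b)) \<union> range (\<lambda>a x. (a, x))))"

definition tensor3_eq ::
    "('k::field \<Rightarrow> 'v::ab_group_add \<Rightarrow> 'v) \<Rightarrow>
     ('v \<times> 'v \<times> 'v \<Rightarrow>\<^sub>0 'k) \<Rightarrow> ('v \<times> 'v \<times> 'v \<Rightarrow>\<^sub>0 'k) \<Rightarrow> bool" where
  "tensor3_eq scale s t \<longleftrightarrow>
     s - t \<in> module.span formal_scale (multilinearity_relations scale
       (range (\<lambda>(b, c) x. (x, b, c)) \<union> range (\<lambda>(a, c) x. (a, x, c)) \<union> range (\<lambda>(a, b) x. (a, b, x))))"

definition tensor2_mult ::
    "('a::comm_ring_1 \<times> 'a \<Rightarrow>\<^sub>0 'k::field) \<Rightarrow> ('a \<times> 'a \<Rightarrow>\<^sub>0 'k) \<Rightarrow> ('a \<times> 'a \<Rightarrow>\<^sub>0 'k)" where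
  "tensor2_mult s t =
     linear_extension formal_scale (\<lambda>(a, b).
       linear_extension formal_scale (\<lambda>(c, d). Poly_Mapping.single (a * c, b * d) 1) t) s"


section \<open>Affine algebraic group schemes\<close>

text \<open>
  The group scheme is given by its coordinate ring: the type \<open>'h\<close> carries \<open>k[H]\<close>, and the
  comultiplication, counit and antipode are the comorphisms of the multiplication, the unit
  \<open>e \<in> H(k)\<close> and the inversion. The value \<open>comult f\<close> is an arbitrary representative of the tensor
  \<open>\<Delta>(f) \<in> k[H] \<otimes> k[H]\<close>, so equations between tensors hold up to \<open>tensor2_eq\<close> and \<open>tensor3_eq\<close>.
\<close>

locale affine_algebraic_group_scheme = comm_algebra scale
  for scale :: "'k::field \<Rightarrow> 'h::comm_ring_1 \<Rightarrow> 'h" +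
  fixes comult :: "'h \<Rightarrow> ('h \<times> 'h \<Rightarrow>\<^sub>0 'k)"
    and counit :: "'h \<Rightarrow> 'k"
    and antipode :: "'h \<Rightarrow> 'h"
  assumes finitely_generated: "finitely_generated_algebra scale"
    and counit_hom: "algebra_hom scale (*) counit"
    and antipode_hom: "algebra_hom scale scale antipode"
    and comult_add: "tensor2_eq scale (comult (f + g)) (comult f + comult g)"
    and comult_scale: "tensor2_eq scale (comult (scale c f)) (formal_scale c (comult f))"
    and comult_one: "tensor2_eq scale (comult 1) (Poly_Mapping.single (1, 1) 1)"
    and comult_mult: "tensor2_eq scale (comult (f * g)) (tensor2_mult (comult f) (comult g))"
    and coassociative:
      "tensor3_eq scale
         (linear_extension formal_scale (\<lambda>(a, b).
            linear_extension formal_scale (\<lambda>(c, d). Poly_Mapping.single (c, d, b) 1) (comult a))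
          (comult f))
         (linear_extension formal_scale (\<lambda>(a, b).
            linear_extension formal_scale (\<lambda>(c, d). Poly_Mapping.single (a, c, d) 1) (comult b))
          (comult f))"
    and counit_left: "linear_extension scale (\<lambda>(a, b). scale (counit a) b) (comult f) = f"
    and counit_right: "linear_extension scale (\<lambda>(a, b). scale (counit b) a) (comult f) = f"
    and antipode_left:
      "linear_extension scale (\<lambda>(a, b). antipode a * b) (comult f) = scale (counit f) 1"
    and antipode_right:
      "linear_extension scale (\<lambda>(a, b). a * antipode b) (comult f) = scale (counit f) 1"


section \<open>Distributions supported at the identity\<close>

definition vanishing_ideal :: "('h \<Rightarrow> 'k::field) \<Rightarrow> 'h set" where
  "vanishing_ideal e = {f. e f = 0}"

definition Dist :: "('k::field \<Rightarrow> 'h::comm_ring_1 \<Rightarrow> 'h) \<Rightarrow> ('h \<Rightarrow> 'k) \<Rightarrow> ('h \<Rightarrow> 'k) set" where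
  "Dist scale counit =
     {u. Vector_Spaces.linear scale (*) u \<and>
         (\<exists>n. \<forall>f\<in>ideal_power (vanishing_ideal counit) n. u f = 0)}"

definition Lie :: "('k::field \<Rightarrow> 'h::comm_ring_1 \<Rightarrow> 'h) \<Rightarrow> ('h \<Rightarrow> 'k) \<Rightarrow> ('h \<Rightarrow> 'k) set" where
  "Lie scale counit =
     {u. Vector_Spaces.linear scale (*) u \<and>
         (\<forall>f\<in>ideal_power (vanishing_ideal counit) 2. u f = 0) \<and> u 1 = 0}"

definition dist_mult ::
    "('h \<Rightarrow> ('h \<times> 'h \<Rightarrow>\<^sub>0 'k::field)) \<Rightarrow> ('h \<Rightarrow> 'k) \<Rightarrow> ('h \<Rightarrow> 'k) \<Rightarrow> ('h \<Rightarrow> 'k)" where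
  "dist_mult comult u v = (\<lambda>f. linear_extension (*) (\<lambda>(a, b). u a * v b) (comult f))"

text \<open>
  \<open>dist_comult scale counit u t\<close>: the combination \<open>t\<close> of pairs of distributions represents
  \<open>\<Delta>(u) \<in> Dist(H) \<otimes> Dist(H)\<close>. Every distribution has such a representative since the quotients
  of \<open>k[H]\<close> by powers of the vanishing ideal are finite dimensional, and the tensor it
  represents is unique since functionals on \<open>k[H]\<close> separate tensors.
\<close>

definition dist_comult ::
    "('k::field \<Rightarrow> 'h::comm_ring_1 \<Rightarrow> 'h) \<Rightarrow> ('h \<Rightarrow> 'k) \<Rightarrow>
     ('h \<Rightarrow> 'k) \<Rightarrow> (('h \<Rightarrow> 'k) \<times> ('h \<Rightarrow> 'k) \<Rightarrow>\<^sub>0 'k) \<Rightarrow> bool" where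
  "dist_comult scale counit u t \<longleftrightarrow>
     Poly_Mapping.keys t \<subseteq> Dist scale counit \<times> Dist scale counit \<and>
     (\<forall>f g. linear_extension (*) (\<lambda>(v, w). v f * w g) t = u (f * g))"


section \<open>Modules and algebras over the distribution algebra\<close>

locale Dist_module =
  affine_algebraic_group_scheme scale comult counit antipode + M: vector_space scaleM
  for scale :: "'k::field \<Rightarrow> 'h::comm_ring_1 \<Rightarrow> 'h"
    and comult counit antipode
    and scaleM :: "'k \<Rightarrow> 'm::ab_group_add \<Rightarrow> 'm" +
  fixes act :: "('h \<Rightarrow> 'k) \<Rightarrow> 'm \<Rightarrow> 'm"
  assumes act_linear:
      "u \<in> Dist scale counit \<Longrightarrow> Vector_Spaces.linear scaleM scaleM (act u)"
    and act_add:
      "u \<in> Dist scale counit \<Longrightarrow> v \<in> Dist scale counit \<Longrightarrow>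
         act (\<lambda>f. u f + v f) x = act u x + act v x"
    and act_scale: "u \<in> Dist scale counit \<Longrightarrow> act (\<lambda>f. c * u f) x = scaleM c (act u x)"
    and act_unit: "act counit x = x"
    and act_mult:
      "u \<in> Dist scale counit \<Longrightarrow> v \<in> Dist scale counit \<Longrightarrow>
         act (dist_mult comult u v) x = act u (act v x)"

locale Dist_algebra =
  Dist_module scale comult counit antipode scaleA act + A: comm_algebra scaleA
  for scale :: "'k::field \<Rightarrow> 'h::comm_ring_1 \<Rightarrow> 'h"
    and comult counit antipode
    and scaleA :: "'k \<Rightarrow> 'a::comm_ring_1 \<Rightarrow> 'a"
    and act +
  assumes act_product:
    "u \<in> Dist scale counit \<Longrightarrow> dist_comult scale counit u t \<Longrightarrow>
       act u (x * y) = linear_extension scaleA (\<lambda>(v, w). act v x * act w y) t"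

definition stable_under :: "('h \<Rightarrow> 'k) set \<Rightarrow> (('h \<Rightarrow> 'k) \<Rightarrow> 'm \<Rightarrow> 'm) \<Rightarrow> 'm set \<Rightarrow> bool" where
  "stable_under U act N \<longleftrightarrow> (\<forall>u\<in>U. \<forall>x\<in>N. act u x \<in> N)"


section \<open>Multiplicative monoids\<close>

definition multiplicative_monoid :: "'a::comm_ring_1 set \<Rightarrow> 'a monoid" where
  "multiplicative_monoid S = \<lparr>carrier = S, monoid.mult = (*), one = 1\<rparr>"

definition stable_elements ::
    "('h \<Rightarrow> 'k) set \<Rightarrow> (('h \<Rightarrow> 'k) \<Rightarrow> 'a::comm_ring_1 \<Rightarrow> 'a) \<Rightarrow> 'a set" where
  "stable_elements U act = {a. a \<noteq> 0 \<and> stable_under U act (principal_ideal a)}"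

end

(*
Let I be the ideal of the identity and D_n the space of distributions vanishing on I^n. Since
I/I^n is finite dimensional, for u in D_(n+1) the comultiplication is
u (x) e + e (x) u - u(1) e (x) e plus a sum of tensors v (x) w with v, w in D_n. Hence, if D_n
preserves the ideals Aa and Ab, then u(ab) = a u(b) + b u(a) modulo ab. By induction on n, this
shows that stability passes to products, to quotients, to coprime factors, and from b^m to b when
m is invertible in k. So an element is stable iff all the prime powers in its factorisation are,
and the stable powers of a prime q are the powers of q^d for some d, which is 1 in
characteristic 0 and a power of p in characteristic p.

In characteristic 0, stability under Lie(H) implies stability under Dist(H): if the f_i form a
basis of I modulo I^2 and the X_i are the invariant derivations of the dual basis x_i, then
E = sum_i f_i X_i acts on I^n/I^(n+1) as multiplication by n. So for u in D_(n+1) the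
distribution n u - u o E lies in D_n, and u o E is the sum of the products u(f_i -) x_i of
elements of D_n and of Lie(H).
*)

theory Submission
  imports Defs
begin

section \<open>Quotient-closed submonoids of factorial domains\<close>

text \<open>The inductions on the order close because both factors of the nontrivial coproduct terms
  drop in order: stability of a and b under D_n alone controls u in D_(n+1). For powers the rule
  becomes u(b^m) = m b^(m-1) u(b) modulo b^m, so the only obstruction to extracting roots is the
  integer m. What remains is arithmetic of a submonoid of A closed under quotients: the exponents of
  the stable powers of q are closed under addition and subtraction, hence are the multiples of the
  least positive one, if there is one. In characteristic p, write it as p^s k with k prime to p; the
  k-th root can be taken, so minimality forces k = 1.

  The distribution n u - u o E lies in D_n because u kills I^(n+1) and E - n maps I^n into I^(n+1).
  The group law serves twice here: it spreads the functional x_i to the derivation X_i of k[H], and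
  it makes composition with X_i the right multiplication by x_i in Dist(H). So u(f_i -) x_i acts as
  x_i followed by u(f_i -), and both preserve Aa, the second by induction.\<close>

lemma multiplicative_monoid_simps [simp]:
  "carrier (multiplicative_monoid S) = S"
  "x \<otimes>\<^bsub>multiplicative_monoid S\<^esub> y = x * y"
  "\<one>\<^bsub>multiplicative_monoid S\<^esub> = 1"
  by (simp_all add: multiplicative_monoid_def)

text \<open>The quotient condition makes divisibility between elements of \<open>S\<close> the same
  in the monoid as in the ring, and containing the units makes the units the same. Notions of the
  monoid thus translate into \<open>dvd\<close>.\<close>

locale quotient_closed_submonoid =
  fixes S :: "'a::idom set"
  assumes zero_notin: "0 \<notin> S"
    and unit_mem: "u dvd 1 \<Longrightarrow> u \<in> S"
    and mult_mem: "x \<in> S \<Longrightarrow> y \<in> S \<Longrightarrow> x * y \<in> S"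
    and quotient_mem: "x \<in> S \<Longrightarrow> x * y \<in> S \<Longrightarrow> y \<in> S"
begin

lemma power_mem: "x \<in> S \<Longrightarrow> x ^ n \<in> S"
  by (induction n) (auto intro: unit_mem mult_mem)

lemma comm_monoid_cancel: "comm_monoid_cancel (multiplicative_monoid S)"
proof (rule comm_monoid_cancelI)
  show "comm_monoid (multiplicative_monoid S)"
    by (rule comm_monoidI) (auto intro: unit_mem mult_mem simp: mult_ac)
qed (use zero_notin in auto)

lemma divides_iff:
  assumes "x \<in> S" "y \<in> S"
  shows "x divides\<^bsub>multiplicative_monoid S\<^esub> y \<longleftrightarrow> x dvd y"
  using quotient_mem[OF assms(1)] assms(2) by (auto simp: factor_def dvd_def)

lemma properfactor_iff:
  assumes "x \<in> S" "y \<in> S"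
  shows "properfactor (multiplicative_monoid S) x y \<longleftrightarrow> x dvd y \<and> \<not> y dvd x"
  using assms by (simp add: properfactor_def divides_iff)

lemma Units_eq: "Units (multiplicative_monoid S) = {u. u dvd 1}"
proof (intro subset_antisym subsetI)
  fix u assume "u \<in> {u. u dvd (1 :: 'a)}"
  then have u: "u dvd 1" by simp
  then obtain v where v: "1 = u * v" by (rule dvdE)
  have "v dvd 1" unfolding v by (rule dvd_triv_right)
  then have "u \<in> S" "v \<in> S" using u unit_mem by simp_all
  moreover have "u * v = 1" "v * u = 1" unfolding v by (simp_all add: mult.commute)
  ultimately show "u \<in> Units (multiplicative_monoid S)"
    unfolding Units_def by (intro CollectI conjI bexI[of _ v]) simp_all
next
  fix u assume "u \<in> Units (multiplicative_monoid S)"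
  then obtain v where "v * u = 1" unfolding Units_def by auto
  then show "u \<in> {u. u dvd 1}" using dvd_triv_right[of u v] by simp
qed

text \<open>HOL-Algebra defines irreducibility through proper factors. If x = a b and x divides a,
  cancelling a shows that b is a unit; otherwise a is a proper factor. Conversely, the cofactor of a
  proper factor lies in \<open>S\<close> and is not a unit.\<close>

lemma irreducible_iff:
  assumes x: "x \<in> S"
  shows "Divisibility.irreducible (multiplicative_monoid S) x \<longleftrightarrow>
    \<not> x dvd 1 \<and> (\<forall>a\<in>S. \<forall>b\<in>S. x = a * b \<longrightarrow> a dvd 1 \<or> b dvd 1)" (is "?L \<longleftrightarrow> ?R")
proof
  assume L: ?L
  have "a dvd 1 \<or> b dvd 1" if ab: "a \<in> S" "b \<in> S" "x = a * b" for a b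
  proof (cases "x dvd a")
    case True
    then obtain c where "a = (a * b) * c" unfolding ab(3) by (rule dvdE)
    then have "a * (b * c) = a * 1" by (simp add: mult_ac)
    then have "b * c = 1" using ab(1) zero_notin by (subst (asm) mult_cancel_left) auto
    then show ?thesis by (metis dvd_triv_left)
  next
    case False
    with L ab x show ?thesis
      by (auto simp: Divisibility.irreducible_def properfactor_def divides_iff Units_eq)
  qed
  with L show ?R by (auto simp: Divisibility.irreducible_def Units_eq)
next
  assume R: ?R
  have "a dvd 1" if a: "a \<in> S" "a dvd x" "\<not> x dvd a" for a
  proof -
    obtain b where b: "x = a * b" using a(2) by (rule dvdE)
    have "b \<in> S" using quotient_mem[OF a(1)] x unfolding b .
    then have "a dvd 1 \<or> b dvd 1" using R a(1) b by blast
    moreover have "\<not> b dvd 1"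
    proof
      assume "b dvd 1"
      then have "a * b dvd a * 1" by (intro mult_dvd_mono) auto
      then show False using a(3) b by simp
    qed
    ultimately show ?thesis by blast
  qed
  then have "a \<in> S \<Longrightarrow> properfactor (multiplicative_monoid S) a x \<Longrightarrow> a dvd 1" for a
    using x by (simp add: properfactor_iff)
  moreover have "\<not> x dvd 1" using R by blast
  ultimately show ?L
    by (simp add: Divisibility.irreducible_def Units_eq)
qed

end

section \<open>Irreducible and prime elements of a factorial domain\<close>

interpretation nonzero: quotient_closed_submonoid "UNIV - {0 :: 'a::idom}"
  by unfold_locales auto

text \<open>The two notions quantify over different sets of factorisations, but the factors of a
  nonzero element are nonzero.\<close>

lemma irreducible_nonzero_iff:
  "Factorial_Ring.irreducible (x :: 'a::idom) \<longleftrightarrow>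
    x \<noteq> 0 \<and> Divisibility.irreducible (multiplicative_monoid (UNIV - {0})) x"
proof (cases "x = 0")
  case True
  then show ?thesis by (simp add: Factorial_Ring.irreducible_def)
next
  case False
  have nz: "a \<in> UNIV - {0} \<and> b \<in> UNIV - {0}" if "x = a * b" for a b
    using that False by simp
  have "(\<forall>a b. x = a * b \<longrightarrow> a dvd 1 \<or> b dvd 1) \<longleftrightarrow>
      (\<forall>a\<in>UNIV - {0}. \<forall>b\<in>UNIV - {0}. x = a * b \<longrightarrow> a dvd 1 \<or> b dvd 1)"
    (is "(\<forall>a b. ?P a b \<longrightarrow> ?Q a b) \<longleftrightarrow> ?R")
  proof
    assume R: ?R
    show "\<forall>a b. ?P a b \<longrightarrow> ?Q a b"
    proof (intro allI impI)
      fix a b assume "?P a b"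
      with nz[OF this] R show "?Q a b" by metis
    qed
  qed metis
  then have "Factorial_Ring.irreducible x \<longleftrightarrow>
      \<not> x dvd 1 \<and> (\<forall>a\<in>UNIV - {0}. \<forall>b\<in>UNIV - {0}. x = a * b \<longrightarrow> a dvd 1 \<or> b dvd 1)"
    unfolding Factorial_Ring.irreducible_def using False by argo
  also have "\<dots> \<longleftrightarrow> Divisibility.irreducible (multiplicative_monoid (UNIV - {0})) x"
    by (rule nonzero.irreducible_iff[symmetric]) (simp add: False)
  finally show ?thesis using False by blast
qed

text \<open>By \<open>prime_power_mem\<close> the q-part of an element of \<open>S\<close> lies in
  \<open>S\<close>; the complementary factor then lies in \<open>S\<close> as a quotient.\<close>

locale factorial_quotient_closed_submonoid = quotient_closed_submonoid S
  for S :: "'a::idom set" +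
  assumes factorial: "factorial_monoid (multiplicative_monoid (UNIV - {0 :: 'a}))"
    and prime_power_mem: "prime_elem q \<Longrightarrow> \<not> q dvd y \<Longrightarrow> q ^ n * y \<in> S \<Longrightarrow> q ^ n \<in> S"
begin

text \<open>Factorial monoids are the cancellative commutative ones with the divisor chain condition
  and prime irreducibles. The first condition gives this well-founded order, on which the inductions
  over divisors run; the second gives \<open>irreducible_imp_prime_elem\<close>.\<close>

lemma wf_proper_dvd: "wf {(x :: 'a, y). x \<noteq> 0 \<and> y \<noteq> 0 \<and> x dvd y \<and> \<not> y dvd x}"
proof -
  have "divisor_chain_condition_monoid (multiplicative_monoid (UNIV - {0 :: 'a}))"
    using conjunct1[OF iffD2[OF factorial_condition_one factorial]] .
  from divisor_chain_condition_monoid.division_wellfounded[OF this] show ?thesis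
    by (rule wf_subset) (clarsimp simp: nonzero.properfactor_iff)
qed

lemma proper_dvd_induct [consumes 1, case_names step]:
  assumes "(x :: 'a) \<noteq> 0"
    and step: "\<And>x. x \<noteq> 0 \<Longrightarrow> (\<And>y. y \<noteq> 0 \<Longrightarrow> y dvd x \<Longrightarrow> \<not> x dvd y \<Longrightarrow> P y) \<Longrightarrow> P x"
  shows "P x"
  using assms(1)
proof (induction x rule: wf_induct_rule[OF wf_proper_dvd])
  case (1 x)
  show ?case
  proof (rule step)
    fix y assume y: "y \<noteq> 0" "y dvd x" "\<not> x dvd y"
    show "P y"
      by (rule "1.IH") (use y "1.prems" in simp_all)
  qed (rule "1.prems")
qed

lemma irreducible_imp_prime_elem:
  assumes "Factorial_Ring.irreducible (q :: 'a)"
  shows "prime_elem q"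
proof -
  have q: "q \<noteq> 0" "Divisibility.irreducible (multiplicative_monoid (UNIV - {0})) q"
    using assms by (simp_all add: irreducible_nonzero_iff)
  have "primeness_condition_monoid (multiplicative_monoid (UNIV - {0 :: 'a}))"
    using conjunct2[OF iffD2[OF factorial_condition_one factorial]] .
  from primeness_condition_monoid.irreducible_prime[OF this, of q] q
  have prime: "Divisibility.prime (multiplicative_monoid (UNIV - {0})) q" by simp
  show ?thesis
  proof (rule prime_elemI)
    show "\<not> q dvd 1"
      using prime by (simp add: Divisibility.prime_def nonzero.Units_eq)
    fix a b assume ab: "q dvd a * b"
    show "q dvd a \<or> q dvd b"
    proof (cases "a = 0 \<or> b = 0")
      case False
      then show ?thesis
        using prime ab q(1) by (simp add: Divisibility.prime_def nonzero.divides_iff)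
    qed auto
  qed (rule q(1))
qed

lemma exists_irreducible_dvd:
  "(x :: 'a) \<noteq> 0 \<Longrightarrow> \<not> x dvd 1 \<Longrightarrow> \<exists>q. Factorial_Ring.irreducible q \<and> q dvd x"
proof (induction x rule: proper_dvd_induct)
  case (step x)
  show ?case
  proof (cases "Factorial_Ring.irreducible x")
    case True
    then show ?thesis by (intro exI[of _ x]) simp
  next
    case False
    then obtain a b where ab: "x = a * b" "\<not> a dvd 1" "\<not> b dvd 1"
      using step.hyps step.prems by (auto simp: Factorial_Ring.irreducible_def)
    have "\<not> x dvd a"
    proof
      assume "x dvd a"
      then have "a * b dvd a * 1" using ab by simp
      then show False using ab step.hyps by (subst (asm) dvd_mult_cancel_left) auto
    qed
    moreover have "a \<noteq> 0" "a dvd x" using ab step.hyps by auto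
    ultimately have "\<exists>q. Factorial_Ring.irreducible q \<and> q dvd a"
      using ab(2) step.IH by blast
    then show ?thesis using dvd_trans[OF _ \<open>a dvd x\<close>] by metis
  qed
qed

text \<open>Dividing by q passes to a proper divisor because q is not a unit, so it can be repeated
  only finitely often.\<close>

lemma exists_prime_power_decomposition:
  assumes q: "prime_elem (q :: 'a)"
  shows "x \<noteq> 0 \<Longrightarrow> \<exists>n y. x = q ^ n * y \<and> \<not> q dvd y"
proof (induction x rule: proper_dvd_induct)
  case (step x)
  show ?case
  proof (cases "q dvd x")
    case False
    then show ?thesis by (intro exI[of _ 0] exI[of _ x]) auto
  next
    case True
    then obtain z where z: "x = q * z" by (rule dvdE)
    have "\<not> x dvd z"
    proof
      assume "x dvd z"
      then have "q * z dvd 1 * z" using z by simp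
      then have "q dvd 1" using step.hyps z by (subst (asm) dvd_mult_cancel_right) auto
      then show False using q prime_elem_not_unit by blast
    qed
    moreover have "z \<noteq> 0" "z dvd x" using z step.hyps by auto
    ultimately have "\<exists>n y. z = q ^ n * y \<and> \<not> q dvd y"
      using step.IH by blast
    then obtain n y where "z = q ^ n * y" "\<not> q dvd y" by blast
    then show ?thesis using z by (intro exI[of _ "Suc n"] exI[of _ y]) auto
  qed
qed

lemma prime_not_dvd_mult: "prime_elem q \<Longrightarrow> \<not> q dvd a \<Longrightarrow> \<not> q dvd b \<Longrightarrow> \<not> q dvd a * (b :: 'a)"
  using prime_elem_dvd_mult_iff by blast

text \<open>For each irreducible q this takes the least positive power in \<open>S\<close>, if there
  is one. These elements turn out to be the irreducible elements of \<open>S\<close>. The unit is a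
  separate factor since it need not be an n-th power.\<close>

definition primary_elements :: "'a set" where
  "primary_elements = {u * q ^ n | u q n. u dvd 1 \<and> Factorial_Ring.irreducible q \<and> n > 0 \<and>
     q ^ n \<in> S \<and> (\<forall>m. 0 < m \<and> m < n \<longrightarrow> q ^ m \<notin> S)}"

text \<open>Division with remainder: dividing \<open>q ^ i\<close> by a power of
  \<open>q ^ n\<close> leaves \<open>q ^ (i mod n)\<close> in \<open>S\<close>, so minimality of n
  forces the remainder to be 0.\<close>

lemma minimal_exponent_dvd:
  assumes n: "n > 0" "q ^ n \<in> S" "\<forall>m. 0 < m \<and> m < n \<longrightarrow> q ^ m \<notin> S" and i: "q ^ i \<in> S"
  shows "n dvd i"
proof -
  have "q ^ (i mod n) \<in> S"
  proof (rule quotient_mem)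
    show "(q ^ n) ^ (i div n) \<in> S" using n(2) by (rule power_mem)
    have "q ^ i = (q ^ n) ^ (i div n) * q ^ (i mod n)"
      unfolding power_mult[symmetric] power_add[symmetric] by simp
    then show "(q ^ n) ^ (i div n) * q ^ (i mod n) \<in> S" using i by simp
  qed
  then have "\<not> 0 < i mod n" using n(3) mod_less_divisor[OF n(1), of i] by auto
  then show ?thesis by auto
qed

lemma primary_elements_mem: "primary_elements \<subseteq> S"
  by (auto simp: primary_elements_def intro: mult_mem unit_mem)

lemma primary_not_unit:
  assumes "x \<in> primary_elements"
  shows "\<not> x dvd 1"
proof
  assume x1: "x dvd 1"
  from assms obtain u q n where x: "x = u * q ^ n" "Factorial_Ring.irreducible q" "n > 0"
    by (auto simp: primary_elements_def)
  then have "q dvd x" by auto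
  with x(2) show False
    using dvd_trans[OF \<open>q dvd x\<close> x1] by (simp add: Factorial_Ring.irreducible_def)
qed

text \<open>The q-exponents i and j of a and b are multiples of n by
  \<open>minimal_exponent_dvd\<close>. Since q divides a b, one of them is positive, hence at least
  n.\<close>

lemma primary_dvd_mult:
  assumes x: "x \<in> primary_elements" and ab: "a \<in> S" "b \<in> S" "x dvd a * b"
  shows "x dvd a \<or> x dvd b"
proof -
  from x obtain u q n where u: "u dvd 1" and q': "Factorial_Ring.irreducible q"
    and x: "x = u * q ^ n" and n: "n > 0" "q ^ n \<in> S" "\<forall>m. 0 < m \<and> m < n \<longrightarrow> q ^ m \<notin> S"
    by (auto simp: primary_elements_def)
  note q = irreducible_imp_prime_elem[OF q']
  obtain i a' where a: "a = q ^ i * a'" "\<not> q dvd a'"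
    using exists_prime_power_decomposition[OF q, of a] ab(1) zero_notin by auto
  obtain j b' where b: "b = q ^ j * b'" "\<not> q dvd b'"
    using exists_prime_power_decomposition[OF q, of b] ab(2) zero_notin by auto
  have "q ^ i \<in> S" "q ^ j \<in> S"
    using prime_power_mem[OF q a(2)] prime_power_mem[OF q b(2)] ab(1,2) unfolding a(1) b(1) by simp_all
  then have "n dvd i" "n dvd j"
    by (simp_all only: minimal_exponent_dvd[OF n])
  moreover have "i > 0 \<or> j > 0"
  proof (rule ccontr)
    assume "\<not> ?thesis"
    then have "a * b = a' * b'" using a b by simp
    moreover have "q dvd x" using x n(1) by auto
    ultimately show False
      using dvd_trans[OF _ ab(3), of q] prime_not_dvd_mult[OF q a(2) b(2)] by simp
  qed
  ultimately have "n \<le> i \<or> n \<le> j" using dvd_imp_le[of n i] dvd_imp_le[of n j] by auto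
  then have "q ^ n dvd q ^ i \<or> q ^ n dvd q ^ j" using le_imp_power_dvd by blast
  then have "q ^ n dvd a \<or> q ^ n dvd b" unfolding a(1) b(1) using dvd_mult2 by blast
  moreover have "x dvd y \<longleftrightarrow> q ^ n dvd y" for y
  proof -
    obtain v where v: "1 = u * v" using u by (rule dvdE)
    have "x dvd x * v" by simp
    also have "x * v = q ^ n * (u * v)" by (simp add: x mult_ac)
    also have "\<dots> = q ^ n" unfolding v[symmetric] by simp
    finally have "x dvd q ^ n" .
    moreover have "q ^ n dvd x" unfolding x by simp
    ultimately show ?thesis using dvd_trans[of x "q ^ n" y] dvd_trans[of "q ^ n" x y] by argo
  qed
  ultimately show ?thesis by metis
qed

text \<open>The q-part of x lies in \<open>S\<close>, so its cofactor is a unit. A smaller positive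
  power of q in \<open>S\<close> would split off as well, again with a cofactor in \<open>S\<close>
  that is not a unit.\<close>

lemma irreducible_imp_primary:
  assumes x: "x \<in> S" "\<not> x dvd 1"
    and irr: "\<And>a b. a \<in> S \<Longrightarrow> b \<in> S \<Longrightarrow> x = a * b \<Longrightarrow> a dvd 1 \<or> b dvd 1"
  shows "x \<in> primary_elements"
proof -
  have x0: "x \<noteq> 0" using x zero_notin by auto
  obtain q where q': "Factorial_Ring.irreducible q" and "q dvd x"
    using exists_irreducible_dvd[OF x0 x(2)] by blast
  note q = irreducible_imp_prime_elem[OF q']
  obtain n y where y: "x = q ^ n * y" "\<not> q dvd y"
    using exists_prime_power_decomposition[OF q x0] by blast
  have n: "n > 0" using \<open>q dvd x\<close> y by (cases n) auto
  have qn: "q ^ n \<in> S" using prime_power_mem[OF q y(2)] x(1) unfolding y(1) .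
  have "y \<in> S" using quotient_mem[OF qn] x(1) unfolding y(1) .
  have not_unit: "\<not> q ^ m dvd 1" if "m > 0" for m
  proof
    assume "q ^ m dvd 1"
    then have "q dvd 1" using dvd_trans[OF dvd_power[of m q]] that by simp
    then show False using q prime_elem_not_unit by blast
  qed
  have "y dvd 1" using irr[OF qn \<open>y \<in> S\<close> y(1)] not_unit[OF n] by blast
  moreover have "\<forall>m. 0 < m \<and> m < n \<longrightarrow> q ^ m \<notin> S"
  proof (intro allI impI)
    fix m assume m: "0 < m \<and> m < n"
    show "q ^ m \<notin> S"
    proof
      assume qm: "q ^ m \<in> S"
      have "q ^ m * (q ^ (n - m) * y) = x"
        using m y by (simp flip: mult.assoc power_add)
      moreover from this have "q ^ (n - m) * y \<in> S" using quotient_mem[OF qm] x(1) by simp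
      ultimately have "q ^ m dvd 1 \<or> q ^ (n - m) * y dvd 1" using irr[OF qm, of "q ^ (n - m) * y"] by simp
      then have "q ^ m dvd 1 \<or> q ^ (n - m) dvd 1" using dvd_mult_left[of "q ^ (n - m)" y 1] by blast
      then show False using not_unit[of m] not_unit[of "n - m"] m by simp
    qed
  qed
  moreover have "x = y * q ^ n" using y(1) by (simp only: mult.commute)
  ultimately show ?thesis
    unfolding primary_elements_def using q' n qn by blast
qed

lemma primary_imp_irreducible:
  assumes x: "x \<in> primary_elements" and ab: "a \<in> S" "b \<in> S" "x = a * b"
  shows "a dvd 1 \<or> b dvd 1"
proof -
  have "x \<noteq> 0" using x primary_elements_mem zero_notin by auto
  then have ab0: "a \<noteq> 0" "b \<noteq> 0" using ab by auto
  have "x dvd a \<or> x dvd b" using primary_dvd_mult[OF x ab(1,2)] ab(3) by simp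
  then show ?thesis
  proof
    assume "x dvd a"
    then have "a * b dvd a * 1" using ab by simp
    then show ?thesis using ab0 by (subst (asm) dvd_mult_cancel_left) auto
  next
    assume "x dvd b"
    then have "a * b dvd 1 * b" using ab by simp
    then show ?thesis using ab0 by (subst (asm) dvd_mult_cancel_right) auto
  qed
qed

lemma irreducible_elements_eq:
  "{x \<in> S. Divisibility.irreducible (multiplicative_monoid S) x} = primary_elements"
proof (intro subset_antisym subsetI)
  fix x assume "x \<in> {x \<in> S. Divisibility.irreducible (multiplicative_monoid S) x}"
  then have x: "x \<in> S" and irr: "Divisibility.irreducible (multiplicative_monoid S) x" by auto
  show "x \<in> primary_elements"
    using irr unfolding irreducible_iff[OF x] by (intro irreducible_imp_primary x) blast+
next
  fix x assume x: "x \<in> primary_elements"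
  then have "x \<in> S" using primary_elements_mem by blast
  moreover have "Divisibility.irreducible (multiplicative_monoid S) x"
    unfolding irreducible_iff[OF \<open>x \<in> S\<close>]
    using primary_not_unit[OF x] primary_imp_irreducible[OF x] by blast
  ultimately show "x \<in> {x \<in> S. Divisibility.irreducible (multiplicative_monoid S) x}" by simp
qed

text \<open>The chain condition restricts from the ring to \<open>S\<close> because divisibility
  agrees; primeness of the irreducible elements is \<open>primary_dvd_mult\<close>.\<close>

lemma factorial_submonoid: "factorial_monoid (multiplicative_monoid S)"
proof -
  interpret comm_monoid_cancel "multiplicative_monoid S" by (rule comm_monoid_cancel)
  have "divisor_chain_condition_monoid (multiplicative_monoid S)"
  proof
    show "wf {(x, y). x \<in> carrier (multiplicative_monoid S) \<and> y \<in> carrier (multiplicative_monoid S) \<and>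
        properfactor (multiplicative_monoid S) x y}"
      using wf_proper_dvd
      by (rule wf_subset) (use zero_notin in \<open>auto simp: properfactor_iff\<close>)
  qed
  moreover have "primeness_condition_monoid (multiplicative_monoid S)"
  proof
    fix x assume "x \<in> carrier (multiplicative_monoid S)"
      and "Divisibility.irreducible (multiplicative_monoid S) x"
    then have x: "x \<in> primary_elements" and "x \<in> S" using irreducible_elements_eq by auto
    then show "Divisibility.prime (multiplicative_monoid S) x"
      using primary_dvd_mult[OF x] primary_not_unit[OF x]
      by (simp add: Divisibility.prime_def Units_eq divides_iff mult_mem)
  qed
  ultimately show ?thesis
    by (intro iffD1[OF factorial_condition_one] conjI)
qed

end

section \<open>Powers of the ideal of the identity\<close>

interpretation ideal: module "(*) :: 'a::comm_ring_1 \<Rightarrow> 'a \<Rightarrow> 'a"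
  by unfold_locales (simp_all add: algebra_simps)

text \<open>As a rewrite rule, this associates products to the left and loops with \<open>mult.assoc\<close>.\<close>

declare ideal.scale_scale [simp del]

lemma ideal_mult_left: "is_ideal J \<Longrightarrow> x \<in> J \<Longrightarrow> y * x \<in> J"
  by (rule ideal.subspace_scale)

lemma ideal_mult_right: "is_ideal J \<Longrightarrow> x \<in> J \<Longrightarrow> x * y \<in> J"
  using ideal.subspace_scale[of J x y] by (simp add: mult.commute)

lemma is_ideal_ideal_power: "is_ideal (ideal_power J n)"
  by (cases n) simp_all

lemma mult_mem_ideal_power_Suc:
  "x \<in> J \<Longrightarrow> y \<in> ideal_power J n \<Longrightarrow> x * y \<in> ideal_power J (Suc n)"
  by (auto intro: ideal.span_base)

lemma ideal_power_Suc_subset: "ideal_power J (Suc n) \<subseteq> ideal_power J n"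
  unfolding ideal_power.simps
  by (rule ideal.span_minimal) (auto intro: ideal_mult_left is_ideal_ideal_power)

lemma ideal_power_1: "is_ideal J \<Longrightarrow> ideal_power J (Suc 0) = J"
proof (rule subset_antisym)
  assume "is_ideal J"
  then show "ideal_power J (Suc 0) \<subseteq> J"
    unfolding ideal_power.simps
    by (intro ideal.span_minimal) (auto intro: ideal_mult_right)
  show "J \<subseteq> ideal_power J (Suc 0)"
  proof
    fix x assume "x \<in> J"
    then show "x \<in> ideal_power J (Suc 0)"
      using mult_mem_ideal_power_Suc[of x J 1 0] by simp
  qed
qed

lemma mult_mem_ideal_power_add:
  "x \<in> ideal_power J m \<Longrightarrow> y \<in> ideal_power J n \<Longrightarrow> x * y \<in> ideal_power J (m + n)"
proof (induction m arbitrary: x)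
  case 0
  then show ?case by (simp add: ideal_mult_left is_ideal_ideal_power)
next
  case (Suc m)
  from Suc.prems(1) have "x \<in> ideal_generated {a * b | a b. a \<in> J \<and> b \<in> ideal_power J m}" by simp
  then show ?case
  proof (induction x rule: ideal.span_induct_alt)
    case base
    then show ?case by (simp add: ideal.subspace_0 is_ideal_ideal_power)
  next
    case (step c z z')
    then obtain a b where ab: "z = a * b" "a \<in> J" "b \<in> ideal_power J m" by blast
    have "a * (b * y) \<in> ideal_power J (Suc (m + n))"
      using ab Suc.IH[OF ab(3) Suc.prems(2)] by (intro mult_mem_ideal_power_Suc)
    then have "c * (a * (b * y)) \<in> ideal_power J (Suc (m + n))"
      by (rule ideal_mult_left[OF is_ideal_ideal_power])
    moreover have "z' * y \<in> ideal_power J (Suc (m + n))"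
      using step.IH unfolding add_Suc .
    ultimately have "c * (a * (b * y)) + z' * y \<in> ideal_power J (Suc (m + n))"
      by (rule ideal.subspace_add[OF is_ideal_ideal_power])
    then show ?case unfolding ab(1) by (simp only: distrib_right mult.assoc add_Suc)
  qed
qed

context comm_algebra
begin

lemma scale_mult_right: "x * scale c y = scale c (x * y)"
  using scale_mult_left[of c y x] by (simp add: mult.commute)

lemma subspace_ideal:
  assumes "is_ideal J"
  shows "subspace J"
proof (rule subspaceI)
  fix c x assume "x \<in> J"
  then have "scale c 1 * x \<in> J" by (rule ideal_mult_left[OF assms])
  then show "scale c x \<in> J" by (simp flip: scale_mult_left)
qed (use assms in \<open>auto intro: ideal.subspace_0 ideal.subspace_add\<close>)

lemma linear_functional_iff:
  "Vector_Spaces.linear scale (*) u \<longleftrightarrow>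
    (\<forall>x y. u (x + y) = u x + u y) \<and> (\<forall>c x. u (scale c x) = c * u x)"
proof -
  have "vector_space ((*) :: 'k \<Rightarrow> 'k \<Rightarrow> 'k)"
    by unfold_locales (simp_all add: distrib_left distrib_right)
  then show ?thesis unfolding Vector_Spaces.linear_iff using vector_space_axioms by satx
qed

end

lemma module_linear_sum:
  "Vector_Spaces.linear s1 s2 u \<Longrightarrow> u (sum g S) = (\<Sum>i\<in>S. u (g i))"
  by (simp add: Vector_Spaces.linear_iff_module_hom module_hom.sum)

section \<open>The ideal I of the identity and the finite-dimensional quotients by its
  powers\<close>

context affine_algebraic_group_scheme
begin

abbreviation aug :: "'h set" where "aug \<equiv> vanishing_ideal counit"

lemma counit_simps [simp]:
  "counit (x + y) = counit x + counit y"
  "counit (scale c x) = c * counit x"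
  "counit 1 = 1"
  "counit (x * y) = counit x * counit y"
  using counit_hom by (simp_all add: algebra_hom_def linear_functional_iff)

lemma linear_counit: "Vector_Spaces.linear scale (*) counit"
  using counit_hom by (simp add: algebra_hom_def)

lemma counit_diff [simp]: "counit (x - y) = counit x - counit y"
  using counit_simps(1)[of "x - y" y] by (simp add: algebra_simps del: counit_simps)

lemma counit_0 [simp]: "counit 0 = 0"
  using counit_diff[of 0 0] by simp

lemma is_ideal_aug: "is_ideal aug"
  by (rule ideal.subspaceI) (auto simp: vanishing_ideal_def)

lemma subspace_aug_power: "subspace (ideal_power aug n)"
  by (rule subspace_ideal[OF is_ideal_ideal_power])

lemma aug_power_Suc_subset_aug: "ideal_power aug (Suc n) \<subseteq> aug"
proof (induction n)
  case (Suc n)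
  then show ?case using ideal_power_Suc_subset[of aug "Suc n"] by blast
qed (simp only: ideal_power_1[OF is_ideal_aug] subset_refl)

text \<open>The projection of k[H] = k 1 + I onto I along k 1.\<close>

definition reduced :: "'h \<Rightarrow> 'h" where
  "reduced g = g - scale (counit g) 1"

lemma reduced_mem_aug: "reduced g \<in> aug"
  by (simp add: reduced_def vanishing_ideal_def)

lemma reduced_eq: "g \<in> aug \<Longrightarrow> reduced g = g"
  by (simp add: reduced_def vanishing_ideal_def)

text \<open>The subspace k 1 + T k[H] is a subalgebra, and it contains every algebra generator s
  because s is \<open>reduced s\<close> plus a constant. So the finite set \<open>T\<close>
  generates the ideal I.\<close>

lemma generation:
  obtains T where "finite T" "T \<subseteq> aug" "span (insert 1 {t * r | t r. t \<in> T}) = UNIV"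
proof -
  obtain S where S: "finite S" "\<And>B. subalgebra scale B \<Longrightarrow> S \<subseteq> B \<Longrightarrow> B = UNIV"
    using finitely_generated by (auto simp: finitely_generated_algebra_def)
  define T where "T = reduced ` S"
  define W where "W = span (insert 1 {t * r | t r. t \<in> T})"
  have subW: "subspace W" unfolding W_def by (rule subspace_span)
  have one: "1 \<in> W" unfolding W_def by (rule span_base) simp
  have tr: "t * r \<in> W" if "t \<in> T" for t r
    unfolding W_def by (rule span_base) (use that in blast)
  have mult: "x * y \<in> W" if x: "x \<in> W" and y: "y \<in> W" for x y
    using x[unfolded W_def]
  proof (induction x rule: span_induct_alt)
    case base
    show ?case by (simp add: subspace_0[OF subW])
  next
    case (step c z z')
    have "z * y \<in> W"
    proof (cases "z = 1")
      case False
      then obtain t r where z: "z = t * r" "t \<in> T" using step.hyps(1) by auto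
      have "t * (r * y) \<in> W" by (rule tr[OF z(2)])
      then show ?thesis unfolding z(1) by (simp only: mult.assoc)
    qed (simp add: y)
    then have "scale c (z * y) + z' * y \<in> W"
      using step.IH by (intro subspace_add[OF subW] subspace_scale[OF subW])
    then show ?case by (simp only: distrib_right scale_mult_left)
  qed
  have "subalgebra scale W"
    unfolding subalgebra_def using one subW mult by blast
  moreover have "S \<subseteq> W"
  proof
    fix s assume "s \<in> S"
    then have "reduced s * 1 + scale (counit s) 1 \<in> W"
      using tr[of "reduced s" 1] one
      by (intro subspace_add[OF subW] subspace_scale[OF subW]) (auto simp: T_def)
    then show "s \<in> W" by (simp add: reduced_def)
  qed
  ultimately have "W = UNIV" by (rule S(2))
  show ?thesis
  proof (rule that[of T])
    show "finite T" using S(1) by (simp add: T_def)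
    show "T \<subseteq> aug" using reduced_mem_aug by (auto simp: T_def)
    show "span (insert 1 {t * r | t r. t \<in> T}) = UNIV" using \<open>W = UNIV\<close> unfolding W_def .
  qed
qed

text \<open>If \<open>B\<close> spans k[H] modulo I^n, then 1 and the products of \<open>T\<close>
  and \<open>B\<close> span it modulo I^(n+1): k[H] = k 1 + T k[H], and replacing r by b in t r
  costs an element of I I^n.\<close>

lemma finite_dimensional_quotient:
  "\<exists>B. finite B \<and> (\<forall>g. \<exists>b\<in>span B. g - b \<in> ideal_power aug n)"
proof (induction n)
  case 0
  show ?case by (intro exI[of _ "{}"]) (simp add: span_empty)
next
  case (Suc n)
  then obtain B where B: "finite B" "\<And>g. \<exists>b\<in>span B. g - b \<in> ideal_power aug n" by blast
  obtain T where T: "finite T" "T \<subseteq> aug" "span (insert 1 {t * r | t r. t \<in> T}) = UNIV"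
    by (rule generation)
  define B' where "B' = insert 1 ((\<lambda>(t, b). t * b) ` (T \<times> B))"
  have mult_B: "t * b \<in> span B'" if t: "t \<in> T" and b: "b \<in> span B" for t b
    using b
  proof (induction b rule: span_induct_alt)
    case base
    show ?case by (simp add: span_zero)
  next
    case (step c z z')
    have "t * z \<in> B'" using t step.hyps(1) unfolding B'_def by force
    then have "scale c (t * z) + t * z' \<in> span B'"
      using step.IH by (intro span_add span_scale[OF span_base])
    then show ?case by (simp only: distrib_left scale_mult_right)
  qed
  have "\<exists>b\<in>span B'. g - b \<in> ideal_power aug (Suc n)" for g
  proof -
    have "g \<in> span (insert 1 {t * r | t r. t \<in> T})" unfolding T(3) by simp
    then show ?thesis
    proof (induction g rule: span_induct_alt)
      case base
      show ?case
        using span_zero subspace_0[OF subspace_aug_power]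
        by (intro bexI[of _ 0]) (simp_all del: ideal_power.simps)
    next
      case (step c z z')
      obtain b' where b': "b' \<in> span B'" "z' - b' \<in> ideal_power aug (Suc n)"
        using step.IH by blast
      have "\<exists>b\<in>span B'. z - b \<in> ideal_power aug (Suc n)"
      proof (cases "z = 1")
        case True
        then show ?thesis
          using span_base[of 1 B'] subspace_0[OF subspace_aug_power, of "Suc n"]
          by (intro bexI[of _ 1]) (simp_all add: B'_def del: ideal_power.simps)
      next
        case False
        then obtain t r where tr: "z = t * r" "t \<in> T" using step.hyps(1) by auto
        obtain b where b: "b \<in> span B" "r - b \<in> ideal_power aug n" using B(2)[of r] by blast
        have "t * (r - b) \<in> ideal_power aug (Suc n)"
          using tr(2) T(2) b(2) by (intro mult_mem_ideal_power_Suc) blast+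
        then have "z - t * b \<in> ideal_power aug (Suc n)"
          unfolding tr(1) by (simp only: right_diff_distrib)
        with mult_B[OF tr(2) b(1)] show ?thesis by (rule bexI[rotated])
      qed
      then obtain b where b: "b \<in> span B'" "z - b \<in> ideal_power aug (Suc n)" by blast
      have "scale c (z - b) + (z' - b') \<in> ideal_power aug (Suc n)"
        using b(2) b'(2)
        by (intro subspace_add[OF subspace_aug_power] subspace_scale[OF subspace_aug_power])
      also have "scale c (z - b) + (z' - b') = (scale c z + z') - (scale c b + b')"
        by (simp add: scale_right_diff_distrib)
      finally have "(scale c z + z') - (scale c b + b') \<in> ideal_power aug (Suc n)" .
      moreover have "scale c b + b' \<in> span B'"
        using b(1) b'(1) by (intro span_add span_scale)
      ultimately show ?case by (rule bexI)
    qed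
  qed
  moreover have "finite B'" using T(1) B(1) by (simp add: B'_def)
  ultimately show ?case by (intro exI[of _ B'] conjI allI)
qed

text \<open>For n > 0 these are a basis of I modulo I^n and its dual basis, the latter extended to
  functionals on k[H] that kill 1. They are coordinate functions of a basis of k[H] adapted to the
  chain of subspaces I^n, I, k[H].\<close>

lemma dual_family:
  obtains F x where "finite F" "F \<subseteq> aug"
    "\<forall>f\<in>F. Vector_Spaces.linear scale (*) (x f) \<and> x f 1 = 0 \<and> (\<forall>g\<in>ideal_power aug n. x f g = 0)"
    "\<forall>g\<in>aug. g - (\<Sum>f\<in>F. scale (x f g) f) \<in> ideal_power aug n"
proof (cases n)
  \<comment> \<open>Here I^0 is the whole ring and not contained in I, but any g lies in it, so the
    empty family serves.\<close>
  case 0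
  with that[of "{}"] show ?thesis by auto
next
  case (Suc m)
  define N where "N = ideal_power aug n"
  have sN: "subspace N" unfolding N_def by (rule subspace_aug_power)
  have N_aug: "N \<subseteq> aug" unfolding N_def Suc by (rule aug_power_Suc_subset_aug)
  have s_aug: "subspace aug" by (rule subspace_ideal[OF is_ideal_aug])
  obtain B where B: "finite B" "\<And>g. \<exists>b\<in>span B. g - b \<in> N"
    using finite_dimensional_quotient[of n] unfolding N_def by auto
  \<comment> \<open>A basis of I^n is extended to a basis of I by some of the finitely many elements
    \<open>reduced b\<close>, so that \<open>C' - C\<close> is finite.\<close>
  obtain C where C: "C \<subseteq> N" "independent C" "N \<subseteq> span C"
    by (rule maximal_independent_subset)
  obtain C' where C': "C \<subseteq> C'" "C' \<subseteq> C \<union> reduced ` B" "independent C'" "C \<union> reduced ` B \<subseteq> span C'"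
    by (rule maximal_independent_subset_extend[OF Un_upper1 C(2)])
  have C'_aug: "span C' \<subseteq> aug"
  proof (rule span_minimal[OF _ s_aug])
    show "C' \<subseteq> aug"
      using C'(2) C(1) N_aug reduced_mem_aug by auto
  qed
  have reduced_span: "reduced b \<in> span C'" if "b \<in> span B" for b
    using that
  proof (induction b rule: span_induct_alt)
    case base
    show ?case by (simp add: reduced_def span_zero)
  next
    case (step c z z')
    have "scale c (reduced z) + reduced z' \<in> span C'"
      using step.hyps(1) step.IH C'(4) by (intro span_add span_scale) auto
    also have "scale c (reduced z) + reduced z' = reduced (scale c z + z')"
      by (simp add: reduced_def scale_right_diff_distrib scale_left_distrib)
    finally show ?case .
  qed
  have aug_span: "g \<in> span C'" if g: "g \<in> aug" for g
  proof -
    obtain b where b: "b \<in> span B" "g - b \<in> N" using B(2)[of g] by blast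
    then have "g - b \<in> aug" using N_aug by blast
    then have "b \<in> aug" using g by (simp add: vanishing_ideal_def)
    then have "b \<in> span C'" using reduced_span[OF b(1)] by (simp add: reduced_eq)
    moreover have "g - b \<in> span C'" using b(2) C(3) span_mono[OF C'(1)] by blast
    ultimately have "(g - b) + b \<in> span C'" using span_add by blast
    then show ?thesis by simp
  qed
  have one: "1 \<notin> span C'" using C'_aug by (auto simp: vanishing_ideal_def)
  \<comment> \<open>With 1 as a basis vector, the coordinates at elements of \<open>C'\<close> kill
    1, and those outside \<open>C\<close> also kill I^n.\<close>
  define K where "K = insert 1 C'"
  have K: "independent K" unfolding K_def by (rule independent_insertI[OF one C'(3)])
  have K_UNIV: "span K = UNIV"
  proof -
    have "g \<in> span K" for g
    proof -
      have "reduced g \<in> span K"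
        using aug_span[OF reduced_mem_aug] span_mono[of C' K] unfolding K_def by blast
      then have "reduced g + scale (counit g) 1 \<in> span K"
        by (rule span_add[OF _ span_scale[OF span_base]]) (simp add: K_def)
      then show ?thesis by (simp add: reduced_def)
    qed
    then show ?thesis by (intro UNIV_eq_I[symmetric])
  qed
  have finite_diff: "finite (C' - C)"
    using C'(2) by (rule finite_subset[rotated, OF finite_imageI[OF B(1), of reduced] Diff_subset_conv[THEN iffD2]])
  define x where "x f g = representation K g f" for f g
  show ?thesis
  proof (rule that[of "C' - C" x]; (intro ballI conjI)?)
    show "finite (C' - C)" by (rule finite_diff)
    show "C' - C \<subseteq> aug" using C'_aug span_superset[of C'] by blast
    fix f assume f: "f \<in> C' - C"
    show "Vector_Spaces.linear scale (*) (x f)"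
      unfolding x_def by (rule linear_representation[OF K K_UNIV])
    have "f \<noteq> 1" using f one span_base[of f C'] by auto
    then show "x f 1 = 0"
      unfolding x_def using representation_basis[OF K, of 1] by (simp add: K_def)
    fix g assume "g \<in> ideal_power aug n"
    then have "g \<in> span C" using C(3) by (auto simp: N_def)
    then have "representation K g = representation C g"
      using C'(1) by (intro representation_extend K) (auto simp: K_def)
    then show "x f g = 0"
      unfolding x_def using representation_ne_zero[of C g f] f by auto
  next
    fix g assume g: "g \<in> aug"
    define Z where "Z = {b. representation C' g b \<noteq> 0}"
    have Z: "finite Z" "Z \<subseteq> C'"
      unfolding Z_def using finite_representation representation_ne_zero by auto
    have rep: "representation K g = representation C' g"
      using aug_span[OF g] by (intro representation_extend K) (auto simp: K_def)
    have "g = (\<Sum>b\<in>Z. scale (x b g) b)"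
      unfolding x_def rep Z_def
      by (rule sum_nonzero_representation_eq[symmetric, OF C'(3) aug_span[OF g]])
    \<comment> \<open>The terms in \<open>C\<close> lie in I^n and form the permitted error.\<close>
    also have "\<dots> = (\<Sum>b\<in>Z - C. scale (x b g) b) + (\<Sum>b\<in>Z \<inter> C. scale (x b g) b)"
      using sum.Int_Diff[OF Z(1), of "\<lambda>b. scale (x b g) b" C] by (simp add: add.commute)
    also have "(\<Sum>b\<in>Z - C. scale (x b g) b) = (\<Sum>b\<in>C' - C. scale (x b g) b)"
    proof (rule sum.mono_neutral_left)
      show "finite (C' - C)" by (rule finite_diff)
      show "Z - C \<subseteq> C' - C" using Z(2) by blast
      show "\<forall>i\<in>C' - C - (Z - C). scale (x i g) i = 0"
        by (auto simp: Z_def x_def rep)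
    qed
    finally have "g - (\<Sum>b\<in>C' - C. scale (x b g) b) = (\<Sum>b\<in>Z \<inter> C. scale (x b g) b)"
      by (simp add: algebra_simps)
    also have "\<dots> \<in> N"
      using C(1) by (intro subspace_sum[OF sN] subspace_scale[OF sN]) auto
    finally show "g - (\<Sum>f\<in>C' - C. scale (x f g) f) \<in> ideal_power aug n"
      by (simp add: N_def)
  qed
qed

end

section \<open>Distributions and invariant derivations\<close>

context vector_space
begin

lemma linear_extension_superset:
  assumes "finite S" "Poly_Mapping.keys t \<subseteq> S"
  shows "linear_extension scale g t = (\<Sum>b\<in>S. scale (Poly_Mapping.lookup t b) (g b))"
  unfolding linear_extension_def
  by (rule sum.mono_neutral_left) (use assms in \<open>auto simp: in_keys_iff\<close>)

lemma linear_extension_add: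
  "linear_extension scale g (s + t) = linear_extension scale g s + linear_extension scale g t"
proof -
  let ?S = "Poly_Mapping.keys s \<union> Poly_Mapping.keys t"
  have "linear_extension scale g (s + t) = (\<Sum>b\<in>?S. scale (Poly_Mapping.lookup (s + t) b) (g b))"
    by (rule linear_extension_superset) (simp_all add: Poly_Mapping.keys_add)
  moreover have "linear_extension scale g s = (\<Sum>b\<in>?S. scale (Poly_Mapping.lookup s b) (g b))"
    by (rule linear_extension_superset) simp_all
  moreover have "linear_extension scale g t = (\<Sum>b\<in>?S. scale (Poly_Mapping.lookup t b) (g b))"
    by (rule linear_extension_superset) simp_all
  ultimately show ?thesis
    by (simp add: lookup_add scale_left_distrib sum.distrib)
qed

lemma linear_extension_scale:
  "linear_extension scale g (formal_scale c t) = scale c (linear_extension scale g t)"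
proof -
  have "Poly_Mapping.keys (formal_scale c t) \<subseteq> Poly_Mapping.keys t"
    by (auto simp: in_keys_iff)
  then have "linear_extension scale g (formal_scale c t)
      = (\<Sum>b\<in>Poly_Mapping.keys t. scale (Poly_Mapping.lookup (formal_scale c t) b) (g b))"
    by (intro linear_extension_superset) simp_all
  then show ?thesis by (simp add: linear_extension_def scale_sum_right)
qed

lemma linear_linear_extension:
  "Vector_Spaces.linear formal_scale scale (linear_extension scale g)"
  unfolding Vector_Spaces.linear_iff
  using formal.vector_space_axioms vector_space_axioms linear_extension_add linear_extension_scale
  by blast

lemma linear_extension_single [simp]:
  "linear_extension scale g (Poly_Mapping.single b c) = scale c (g b)"
  by (simp add: linear_extension_def)

lemma linear_extension_sum:
  "linear_extension scale g (\<Sum>i\<in>S. t i) = (\<Sum>i\<in>S. linear_extension scale g (t i))"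
  by (rule module_linear_sum[OF linear_linear_extension])

text \<open>The universal property of the tensor product: a bilinear map annihilates the relations.
  It makes values computed from \<open>comult f\<close> independent of the chosen
  representative.\<close>

lemma linear_extension_cong_tensor2:
  assumes add1: "\<And>a a' b. g (a + a', b) = g (a, b) + g (a', b)"
    and add2: "\<And>a b b'. g (a, b + b') = g (a, b) + g (a, b')"
    and scale1: "\<And>c a b. g (scaleV c a, b) = scale c (g (a, b))"
    and scale2: "\<And>c a b. g (a, scaleV c b) = scale c (g (a, b))"
    and eq: "tensor2_eq scaleV s t"
  shows "linear_extension scale g s = linear_extension scale g t"
proof -
  interpret L: Vector_Spaces.linear formal_scale scale "linear_extension scale g"
    by (rule linear_linear_extension)
  have "linear_extension scale g r = 0"
    if "r \<in> multilinearity_relations scaleV (range (\<lambda>b x. (x, b)) \<union> range (\<lambda>a x. (a, x)))" for r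
    using that
    by (auto simp: multilinearity_relations_def L.diff add1 add2 scale1 scale2)
  then have "linear_extension scale g (s - t) = 0"
    using eq[unfolded tensor2_eq_def] by (rule L.eq_0_on_span)
  then show ?thesis by (simp add: L.diff)
qed

end

lemma linear_linear_extension_apply:
  assumes "Vector_Spaces.linear s1 s2 L"
  shows "L (linear_extension s1 g t) = linear_extension s2 (\<lambda>b. L (g b)) t"
proof -
  interpret L: Vector_Spaces.linear s1 s2 L by fact
  show ?thesis by (simp add: linear_extension_def L.sum L.scale)
qed

lemma (in comm_algebra) linear_extension_mult:
  "linear_extension scale p s * linear_extension scale q t =
    linear_extension scale (\<lambda>a. linear_extension scale (\<lambda>b. p a * q b) t) s"
  unfolding linear_extension_def sum_product scale_sum_right
  by (intro sum.cong refl)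
    (simp add: scale_mult_left[symmetric] scale_mult_right mult.commute)

section \<open>The order filtration of Dist(H), its coproduct, and invariant derivations\<close>

context affine_algebraic_group_scheme
begin

text \<open>The index is shifted by one against the order of a distribution: \<open>counit\<close>
  has order 0 and lies in \<open>Dist_order 1\<close>. As \<open>Dist_order 0\<close> is zero,
  inductions on the index start trivially.\<close>

definition Dist_order :: "nat \<Rightarrow> ('h \<Rightarrow> 'k) set" where
  "Dist_order n = {u. Vector_Spaces.linear scale (*) u \<and> (\<forall>f\<in>ideal_power aug n. u f = 0)}"

lemma Dist_eq: "Dist scale counit = (\<Union>n. Dist_order n)"
  by (auto simp: Dist_def Dist_order_def)

lemma Dist_order_subset: "Dist_order n \<subseteq> Dist scale counit"
  unfolding Dist_eq by blast

lemma Dist_order_Suc: "Dist_order n \<subseteq> Dist_order (Suc n)"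
  unfolding Dist_order_def using ideal_power_Suc_subset[of aug n] by blast

lemma Dist_order_0: "u \<in> Dist_order 0 \<Longrightarrow> u = (\<lambda>f. 0)"
  by (auto simp: Dist_order_def)

lemma linear_functional_simps:
  assumes "Vector_Spaces.linear scale (*) u"
  shows "u (x + y) = u x + u y" "u (scale c x) = c * u x" "u (x - y) = u x - u y" "u 0 = 0"
    "u (sum g S) = (\<Sum>i\<in>S. u (g i))"
proof -
  interpret Vector_Spaces.linear scale "(*)" u by fact
  show "u (x + y) = u x + u y" "u (scale c x) = c * u x" "u (x - y) = u x - u y" "u 0 = 0"
    "u (sum g S) = (\<Sum>i\<in>S. u (g i))"
    by (simp_all only: add scale diff zero sum)
qed

lemma counit_mem_Dist_order: "counit \<in> Dist_order (Suc 0)"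
proof -
  have "\<forall>f\<in>ideal_power aug (Suc 0). counit f = 0"
    unfolding ideal_power_1[OF is_ideal_aug] by (simp add: vanishing_ideal_def)
  then show ?thesis unfolding Dist_order_def using linear_counit by blast
qed

lemma Lie_eq: "Lie scale counit = {u \<in> Dist_order 2. u 1 = 0}"
  by (simp add: Lie_def Dist_order_def)

text \<open>Splitting f and g into value at e and reduced part yields the three explicit coproduct
  terms; what remains depends only on u on products of elements of I.\<close>

lemma functional_mult:
  assumes u: "Vector_Spaces.linear scale (*) u"
  shows "u (f * g) = counit f * u g + counit g * u f - counit f * counit g * u 1
    + u (reduced f * reduced g)"
proof -
  have "reduced f * reduced g =
      f * g - scale (counit f) g - scale (counit g) f + scale (counit f * counit g) 1"
    by (simp add: reduced_def right_diff_distrib left_diff_distrib scale_right_diff_distrib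
        scale_mult_left[symmetric] scale_mult_right)
  then show ?thesis by (simp add: linear_functional_simps[OF u])
qed

text \<open>The product of the reduced parts lies in I^2, where x vanishes, so x is a derivation at
  the point e.\<close>

lemma Lie_mult:
  assumes "x \<in> Lie scale counit"
  shows "x (f * g) = counit f * x g + counit g * x f"
proof -
  have x: "Vector_Spaces.linear scale (*) x" "\<forall>f\<in>ideal_power aug 2. x f = 0" "x 1 = 0"
    using assms by (simp_all add: Lie_eq Dist_order_def)
  have "reduced f * reduced g \<in> ideal_power aug (Suc (Suc 0))"
    by (intro mult_mem_ideal_power_Suc reduced_mem_aug)
      (simp only: ideal_power_1[OF is_ideal_aug] reduced_mem_aug)
  then have "x (reduced f * reduced g) = 0" using x(2) by (simp only: numeral_2_eq_2)
  then show ?thesis by (simp add: functional_mult[OF x(1), of f g] x(3))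
qed

text \<open>Multiplication by f maps I^n into I^(n+1), where u vanishes.\<close>

lemma Dist_order_translate:
  assumes u: "u \<in> Dist_order (Suc n)" and f: "f \<in> aug"
  shows "(\<lambda>g. u (f * g)) \<in> Dist_order n"
proof -
  have lin: "Vector_Spaces.linear scale (*) u" using u by (simp add: Dist_order_def)
  have "\<forall>g\<in>ideal_power aug n. u (f * g) = 0"
    using u mult_mem_ideal_power_Suc[OF f] by (simp add: Dist_order_def del: ideal_power.simps)
  then show ?thesis
    by (simp add: Dist_order_def linear_functional_iff distrib_left scale_mult_right
        linear_functional_simps[OF lin])
qed

text \<open>Take a dual family of I modulo I^n. Replacing \<open>reduced g\<close> by its expansion
  in this family costs an element of I^n; multiplied by \<open>reduced f\<close> it lies in I^(n+1),
  which u kills. This writes u on products of elements of I as a sum of v_i(f) x_i(g).\<close>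

lemma exists_dist_comult:
  assumes u: "u \<in> Dist_order (Suc n)"
  obtains F :: "'h set" and v w where "finite F"
    "\<And>i. i \<in> F \<Longrightarrow> v i \<in> Dist_order n" "\<And>i. i \<in> F \<Longrightarrow> w i \<in> Dist_order n"
    "dist_comult scale counit u (Poly_Mapping.single (counit, u) 1 + Poly_Mapping.single (u, counit) 1
      + Poly_Mapping.single (counit, counit) (- u 1) + (\<Sum>i\<in>F. Poly_Mapping.single (v i, w i) 1))"
proof -
  have lin: "Vector_Spaces.linear scale (*) u" using u by (simp add: Dist_order_def)
  obtain F x where F: "finite F" "F \<subseteq> aug"
    and x': "\<forall>f\<in>F. Vector_Spaces.linear scale (*) (x f) \<and> x f 1 = 0 \<and> (\<forall>g\<in>ideal_power aug n. x f g = 0)"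
    and dual: "\<forall>g\<in>aug. g - (\<Sum>f\<in>F. scale (x f g) f) \<in> ideal_power aug n"
    by (rule dual_family[of n])
  have x: "Vector_Spaces.linear scale (*) (x f)" "x f 1 = 0" if "f \<in> F" for f
    using x' that by blast+
  \<comment> \<open>Because of \<open>reduced\<close>, these functionals vanish on constants; the
    constants are already accounted for by the three explicit terms.\<close>
  define v where "v f = (\<lambda>g. u (reduced g * f))" for f
  have x_mem: "x f \<in> Dist_order n" if "f \<in> F" for f
    using x' that by (simp add: Dist_order_def)
  have v_mem: "v f \<in> Dist_order n" if f: "f \<in> F" for f
  proof (cases n)
    \<comment> \<open>As \<open>Dist_order 0\<close> is zero, \<open>v f\<close> has to vanish
      identically. Its values are values on I of a u in \<open>Dist_order 1\<close>.\<close>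
    case 0
    have "v f g = 0" for g
    proof -
      have "reduced g * f \<in> ideal_power aug (Suc 0)"
        unfolding ideal_power_1[OF is_ideal_aug] using f F(2)
        by (intro ideal_mult_left is_ideal_aug) blast
      then show ?thesis using u 0 by (simp add: v_def Dist_order_def del: ideal_power.simps)
    qed
    then show ?thesis by (simp add: Dist_order_def linear_functional_iff)
  next
    case (Suc m)
    have "v f g = u (f * g)" if "g \<in> ideal_power aug n" for g
    proof -
      have "g \<in> aug" using that aug_power_Suc_subset_aug unfolding Suc by blast
      then show ?thesis by (simp add: v_def reduced_eq mult.commute)
    qed
    moreover have "u (f * g) = 0" if "g \<in> ideal_power aug n" for g
      using u that f F(2) mult_mem_ideal_power_Suc[of f aug g n]
      by (simp add: Dist_order_def subset_iff del: ideal_power.simps)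
    ultimately have "\<forall>g\<in>ideal_power aug n. v f g = 0" by simp
    moreover have "Vector_Spaces.linear scale (*) (v f)"
      by (simp add: linear_functional_iff v_def reduced_def distrib_right left_diff_distrib
          scale_mult_left[symmetric] scale_left_distrib linear_functional_simps[OF lin]
          right_diff_distrib)
    ultimately show ?thesis by (simp add: Dist_order_def)
  qed
  have reduced_product: "u (reduced f * reduced g) = (\<Sum>i\<in>F. v i f * x i g)" for f g
  proof -
    have "reduced f * (reduced g - (\<Sum>i\<in>F. scale (x i (reduced g)) i)) \<in> ideal_power aug (Suc n)"
      by (intro mult_mem_ideal_power_Suc reduced_mem_aug dual[rule_format])
    then have "u (reduced f * (reduced g - (\<Sum>i\<in>F. scale (x i (reduced g)) i))) = 0"
      using u by (simp add: Dist_order_def del: ideal_power.simps)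
    then have "u (reduced f * reduced g) = (\<Sum>i\<in>F. x i (reduced g) * v i f)"
      by (simp add: right_diff_distrib sum_distrib_left scale_mult_right v_def
          linear_functional_simps[OF lin])
    also have "\<dots> = (\<Sum>i\<in>F. v i f * x i g)"
    proof (rule sum.cong)
      fix i assume i: "i \<in> F"
      show "x i (reduced g) * v i f = v i f * x i g"
        using x(2)[OF i] by (simp add: reduced_def linear_functional_simps[OF x(1)[OF i]])
    qed simp
    finally show ?thesis .
  qed
  interpret K: vector_space "(*) :: 'k \<Rightarrow> 'k \<Rightarrow> 'k"
    by unfold_locales (simp_all add: distrib_left distrib_right)
  let ?t = "Poly_Mapping.single (counit, u) 1 + Poly_Mapping.single (u, counit) 1
      + Poly_Mapping.single (counit, counit) (- u 1) + (\<Sum>i\<in>F. Poly_Mapping.single (v i, x i) 1)"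
  let ?S = "{(counit, u), (u, counit), (counit, counit)} \<union> (\<lambda>i. (v i, x i)) ` F"
  have "Poly_Mapping.lookup ?t b = 0" if "b \<notin> ?S" for b
  proof -
    have "Poly_Mapping.lookup (\<Sum>i\<in>F. Poly_Mapping.single (v i, x i) (1 :: 'k)) b = 0"
      unfolding lookup_sum using that by (intro sum.neutral ballI lookup_single_not_eq) blast
    moreover have "(counit, u) \<noteq> b" "(u, counit) \<noteq> b" "(counit, counit) \<noteq> b"
      using that by blast+
    ultimately show ?thesis by (simp add: lookup_add lookup_single_not_eq)
  qed
  then have "Poly_Mapping.keys ?t \<subseteq> ?S"
    unfolding in_keys_iff[abs_def] subset_iff by blast
  also have "\<dots> \<subseteq> Dist scale counit \<times> Dist scale counit"
  proof -
    have "u \<in> Dist scale counit" "counit \<in> Dist scale counit"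
      using u counit_mem_Dist_order Dist_order_subset by blast+
    moreover have "(\<lambda>i. (v i, x i)) ` F \<subseteq> Dist scale counit \<times> Dist scale counit"
      using v_mem x_mem Dist_order_subset by blast
    ultimately show ?thesis by simp
  qed
  finally have "Poly_Mapping.keys ?t \<subseteq> Dist scale counit \<times> Dist scale counit" .
  moreover have "linear_extension (*) (\<lambda>(v, w). v f * w g) ?t = u (f * g)" for f g
  proof -
    have "linear_extension (*) (\<lambda>(v, w). v f * w g) ?t =
        counit f * u g + u f * counit g - u 1 * (counit f * counit g) + (\<Sum>i\<in>F. v i f * x i g)"
      by (simp add: K.linear_extension_add K.linear_extension_sum)
    also have "\<dots> = u (f * g)"
      unfolding functional_mult[OF lin, of f g] reduced_product by (simp only: mult_ac)
    finally show ?thesis .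
  qed
  ultimately have "dist_comult scale counit u ?t"
    unfolding dist_comult_def by blast
  with F(1) v_mem x_mem show ?thesis by (rule that)
qed

text \<open>The operator (id \<otimes> x) o Delta: its value on f at a point g is x applied to the
  function h |-> f(g h), so it commutes with left translations.\<close>

definition left_invariant_map :: "('h \<Rightarrow> 'k) \<Rightarrow> 'h \<Rightarrow> 'h" where
  "left_invariant_map x f = linear_extension scale (\<lambda>(a, b). scale (x b) a) (comult f)"

context
  fixes x
  assumes linear_x: "Vector_Spaces.linear scale (*) x"
begin

lemma left_invariant_map_eq:
  assumes "tensor2_eq scale (comult f) t"
  shows "left_invariant_map x f = linear_extension scale (\<lambda>(a, b). scale (x b) a) t"
  unfolding left_invariant_map_def using assms
  by (intro linear_extension_cong_tensor2)
    (simp_all add: scale_right_distrib scale_left_distrib linear_functional_simps[OF linear_x] mult.commute)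

lemma left_invariant_map_add:
  "left_invariant_map x (f + g) = left_invariant_map x f + left_invariant_map x g"
  unfolding left_invariant_map_eq[OF comult_add]
  by (simp add: linear_extension_add left_invariant_map_def)

lemma left_invariant_map_scale:
  "left_invariant_map x (scale c f) = scale c (left_invariant_map x f)"
  unfolding left_invariant_map_eq[OF comult_scale]
  by (simp add: linear_extension_scale left_invariant_map_def)

text \<open>Composition with the operator of x is right multiplication by x in Dist(H). This turns
  identities between operators on k[H] into identities between distributions acting on A.\<close>

lemma functional_left_invariant_map:
  assumes "Vector_Spaces.linear scale (*) u"
  shows "u (left_invariant_map x f) = dist_mult comult u x f"
  unfolding left_invariant_map_def dist_mult_def linear_linear_extension_apply[OF assms]
  by (simp add: case_prod_unfold linear_functional_simps[OF assms] mult.commute)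

lemma counit_left_invariant_map: "counit (left_invariant_map x f) = x f"
proof -
  have "x f = x (linear_extension scale (\<lambda>(a, b). scale (counit a) b) (comult f))"
    by (simp only: counit_left)
  also have "\<dots> = dist_mult comult counit x f"
    unfolding dist_mult_def linear_linear_extension_apply[OF linear_x]
    by (simp add: case_prod_unfold linear_functional_simps[OF linear_x])
  finally show ?thesis by (simp only: functional_left_invariant_map[OF linear_counit])
qed

end

text \<open>Apply id \<otimes> x to Delta(f) Delta(g): x is a derivation at e, and id \<otimes>
  \<open>counit\<close> recovers f from Delta(f).\<close>

lemma left_invariant_map_mult:
  assumes x: "x \<in> Lie scale counit"
  shows "left_invariant_map x (f * g) = f * left_invariant_map x g + left_invariant_map x f * g"
proof -
  have lin: "Vector_Spaces.linear scale (*) x" using x by (simp add: Lie_def)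
  define p where "p = (\<lambda>(a, b). scale (counit b) a)"
  define q where "q = (\<lambda>(a, b). scale (x b) a)"
  have p: "linear_extension scale p (comult h) = h" for h
    unfolding p_def by (rule counit_right)
  have q: "linear_extension scale q (comult h) = left_invariant_map x h" for h
    by (simp add: q_def left_invariant_map_def)
  have pq: "q (a * c, b * d) = p (a, b) * q (c, d) + q (a, b) * p (c, d)" for a b c d
    by (simp add: p_def q_def Lie_mult[OF x] scale_left_distrib scale_mult_left[symmetric] scale_mult_right mult.commute)
  have add_fun: "linear_extension scale (\<lambda>b. r b + r' b) t
      = linear_extension scale r t + linear_extension scale r' t" for r r' and t :: "'h \<times> 'h \<Rightarrow>\<^sub>0 'k"
    by (simp add: linear_extension_def scale_right_distrib sum.distrib)
  have "left_invariant_map x (f * g) = linear_extension scale q (tensor2_mult (comult f) (comult g))"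
    unfolding q_def by (rule left_invariant_map_eq[OF lin comult_mult])
  also have "\<dots> = linear_extension scale (\<lambda>s. linear_extension scale (\<lambda>t. p s * q t + q s * p t) (comult g)) (comult f)"
    unfolding tensor2_mult_def linear_linear_extension_apply[OF linear_linear_extension]
    by (simp add: case_prod_unfold pq linear_linear_extension_apply[OF linear_linear_extension])
  also have "\<dots> = f * left_invariant_map x g + left_invariant_map x f * g"
    by (simp only: add_fun linear_extension_mult[symmetric] p q)
  finally show ?thesis .
qed

end

section \<open>Invariant derivations, the Euler operator and the powers of I\<close>

context affine_algebraic_group_scheme
begin

text \<open>A derivation X lowers powers of an ideal by at most one. In X(a b) = a X(b) + X(a) b the
  first term is covered by induction, and in the second b already lies in the required
  power.\<close>

lemma left_invariant_map_aug_power: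
  assumes x: "x \<in> Lie scale counit"
  shows "f \<in> ideal_power aug (Suc n) \<Longrightarrow> left_invariant_map x f \<in> ideal_power aug n"
proof (induction n arbitrary: f)
  case 0
  then show ?case by simp
next
  case (Suc n)
  have lin: "Vector_Spaces.linear scale (*) x" using x by (simp add: Lie_def)
  have "f \<in> ideal_generated {a * b | a b. a \<in> aug \<and> b \<in> ideal_power aug (Suc n)}"
    using Suc.prems by simp
  then show ?case
  proof (induction f rule: ideal.span_induct_alt)
    case base
    have "left_invariant_map x 0 = 0"
      using left_invariant_map_scale[OF lin, of 0 0] by simp
    then show ?case by (simp add: ideal.subspace_0 is_ideal_ideal_power del: ideal_power.simps)
  next
    case (step c z z')
    then obtain a b where z: "z = a * b" and a: "a \<in> aug" and b: "b \<in> ideal_power aug (Suc n)"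
      by blast
    \<comment> \<open>The ring coefficient is absorbed into the factor from I, so that the product
      rule is applied to a single product.\<close>
    have ca: "c * a \<in> aug" using a by (rule ideal_mult_left[OF is_ideal_aug])
    have "(c * a) * left_invariant_map x b \<in> ideal_power aug (Suc n)"
      using ca Suc.IH[OF b] by (rule mult_mem_ideal_power_Suc)
    moreover have "left_invariant_map x (c * a) * b \<in> ideal_power aug (Suc n)"
      using b by (rule ideal_mult_left[OF is_ideal_ideal_power])
    ultimately have "left_invariant_map x ((c * a) * b) \<in> ideal_power aug (Suc n)"
      unfolding left_invariant_map_mult[OF x] by (rule ideal.subspace_add[OF is_ideal_ideal_power])
    then show ?case
      unfolding left_invariant_map_add[OF lin] z mult.assoc[symmetric] using step.IH
      by (rule ideal.subspace_add[OF is_ideal_ideal_power])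
  qed
qed

text \<open>
  Used for dual bases \<open>F\<close> of \<open>I\<close> modulo \<open>I\<^sup>2\<close> and \<open>x\<close> of \<open>Lie(H)\<close>, where it plays the
  role of the Euler vector field.
\<close>

definition euler_map :: "'h set \<Rightarrow> ('h \<Rightarrow> 'h \<Rightarrow> 'k) \<Rightarrow> 'h \<Rightarrow> 'h" where
  "euler_map F x g = (\<Sum>f\<in>F. f * left_invariant_map (x f) g)"

context
  fixes F x
  assumes F: "F \<subseteq> aug" and x: "f \<in> F \<Longrightarrow> x f \<in> Lie scale counit"
    and dual: "g \<in> aug \<Longrightarrow> g - (\<Sum>f\<in>F. scale (x f g) f) \<in> ideal_power aug 2"
begin

lemma linear_x: "f \<in> F \<Longrightarrow> Vector_Spaces.linear scale (*) (x f)"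
  using x by (simp add: Lie_def)

lemma euler_map_add: "euler_map F x (g + h) = euler_map F x g + euler_map F x h"
  unfolding euler_map_def sum.distrib[symmetric]
  by (intro sum.cong refl) (simp add: left_invariant_map_add[OF linear_x] distrib_left)

lemma euler_map_mult: "euler_map F x (g * h) = g * euler_map F x h + h * euler_map F x g"
  unfolding euler_map_def sum_distrib_left sum.distrib[symmetric]
proof (rule sum.cong)
  fix f assume "f \<in> F"
  show "f * left_invariant_map (x f) (g * h) =
      g * (f * left_invariant_map (x f) h) + h * (f * left_invariant_map (x f) g)"
    unfolding left_invariant_map_mult[OF x[OF \<open>f \<in> F\<close>]] by (simp only: distrib_left mult_ac)
qed simp

text \<open>Modulo I, X_f(g) is the constant x_f(g), so f X_f(g) is x_f(g) f modulo I^2. By duality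
  these sum to g.\<close>

lemma euler_map_aug:
  assumes g: "g \<in> aug"
  shows "euler_map F x g - g \<in> ideal_power aug (Suc (Suc 0))"
proof -
  have "f * (left_invariant_map (x f) g - scale (x f g) 1) \<in> ideal_power aug (Suc (Suc 0))"
    if f: "f \<in> F" for f
  proof (rule mult_mem_ideal_power_Suc)
    show "f \<in> aug" using f F by blast
    show "left_invariant_map (x f) g - scale (x f g) 1 \<in> ideal_power aug (Suc 0)"
      unfolding ideal_power_1[OF is_ideal_aug]
      by (simp add: vanishing_ideal_def counit_left_invariant_map[OF linear_x[OF f]])
  qed
  then have "(\<Sum>f\<in>F. f * (left_invariant_map (x f) g - scale (x f g) 1))
      \<in> ideal_power aug (Suc (Suc 0))"
    by (rule ideal.subspace_sum[OF is_ideal_ideal_power])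
  then have "(\<Sum>f\<in>F. f * (left_invariant_map (x f) g - scale (x f g) 1)) -
      (g - (\<Sum>f\<in>F. scale (x f g) f)) \<in> ideal_power aug (Suc (Suc 0))"
    using dual[OF g, unfolded numeral_2_eq_2] by (rule ideal.subspace_diff[OF is_ideal_ideal_power])
  also have "(\<Sum>f\<in>F. f * (left_invariant_map (x f) g - scale (x f g) 1)) -
      (g - (\<Sum>f\<in>F. scale (x f g) f)) = euler_map F x g - g"
    by (simp add: euler_map_def right_diff_distrib scale_mult_right sum_subtractf)
  finally show ?thesis .
qed

text \<open>Euler's relation: degrees add under a derivation. For d in I and b in I^n, E(d b) = d
  E(b) + b E(d) is n d b + d b modulo I^(n+2).\<close>

lemma euler_map_aug_power:
  "g \<in> ideal_power aug n \<Longrightarrow> euler_map F x g - of_nat n * g \<in> ideal_power aug (Suc n)"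
proof (induction n arbitrary: g)
  case 0
  have "euler_map F x g \<in> aug"
    unfolding euler_map_def using F
    by (intro ideal.subspace_sum[OF is_ideal_aug] ideal_mult_right[OF is_ideal_aug]) blast
  then show ?case by (simp only: ideal_power_1[OF is_ideal_aug] of_nat_0 mult_zero_left diff_zero)
next
  case (Suc n)
  have "g \<in> ideal_generated {a * b | a b. a \<in> aug \<and> b \<in> ideal_power aug n}"
    using Suc.prems by simp
  then show ?case
  proof (induction g rule: ideal.span_induct_alt)
    case base
    have "euler_map F x 0 = 0" using euler_map_add[of 0 0] by simp
    then show ?case by (simp add: ideal.subspace_0 is_ideal_ideal_power del: ideal_power.simps)
  next
    case (step c z z')
    then obtain a b where z: "z = a * b" and a: "a \<in> aug" and b: "b \<in> ideal_power aug n"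
      by blast
    define d where "d = c * a"
    have d: "d \<in> aug" unfolding d_def using a by (rule ideal_mult_left[OF is_ideal_aug])
    have "d * (euler_map F x b - of_nat n * b) \<in> ideal_power aug (Suc (Suc n))"
      using d Suc.IH[OF b] by (rule mult_mem_ideal_power_Suc)
    moreover have "(euler_map F x d - d) * b \<in> ideal_power aug (Suc (Suc n))"
      using mult_mem_ideal_power_add[OF euler_map_aug[OF d] b] by (simp only: add_Suc add_0)
    ultimately have "d * (euler_map F x b - of_nat n * b) + (euler_map F x d - d) * b
        \<in> ideal_power aug (Suc (Suc n))"
      by (rule ideal.subspace_add[OF is_ideal_ideal_power])
    then have "d * (euler_map F x b - of_nat n * b) + (euler_map F x d - d) * b
        + (euler_map F x z' - of_nat (Suc n) * z') \<in> ideal_power aug (Suc (Suc n))"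
      using step.IH by (rule ideal.subspace_add[OF is_ideal_ideal_power])
    also have "d * (euler_map F x b - of_nat n * b) + (euler_map F x d - d) * b
        + (euler_map F x z' - of_nat (Suc n) * z')
        = euler_map F x (d * b + z') - of_nat (Suc n) * (d * b + z')"
    proof -
      have "d * (B - k * b) + (D - d) * b + (Z - (1 + k) * z') =
          (d * B + b * D + Z) - (1 + k) * (d * b + z')" for B D Z k
        by (simp add: algebra_simps)
      then show ?thesis by (simp only: euler_map_add euler_map_mult of_nat_Suc)
    qed
    finally show ?case unfolding z d_def mult.assoc .
  qed
qed

end

end

section \<open>Stable elements of a domain\<close>

locale Dist_domain = Dist_algebra scale comult counit antipode scaleA act
  for scale :: "'k::field \<Rightarrow> 'h::comm_ring_1 \<Rightarrow> 'h"
    and comult counit antipode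
    and scaleA :: "'k \<Rightarrow> 'a::idom \<Rightarrow> 'a"
    and act
begin

lemma dvd_scaleA: "a dvd b \<Longrightarrow> a dvd scaleA c b"
  using A.scale_mult_left[of c 1 b] by simp

lemma act_zero: "act (\<lambda>f. 0) a = 0"
  using act_scale[of counit 0 a] counit_mem_Dist_order Dist_order_subset by auto

text \<open>The coproduct representative depends on u alone, so the same families \<open>v\<close>
  and \<open>w\<close> serve all a and b.\<close>

lemma act_mult_expansion:
  assumes u: "u \<in> Dist_order (Suc n)"
  obtains F :: "'h set" and v w where
    "\<forall>i\<in>F. v i \<in> Dist_order n \<and> w i \<in> Dist_order n"
    "\<forall>a b. act u (a * b) = a * act u b + act u a * b - scaleA (u 1) (a * b)
      + (\<Sum>i\<in>F. act (v i) a * act (w i) b)"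
proof -
  obtain F :: "'h set" and v w where F: "finite F"
    "\<forall>i\<in>F. v i \<in> Dist_order n \<and> w i \<in> Dist_order n"
    and t: "dist_comult scale counit u (Poly_Mapping.single (counit, u) 1 + Poly_Mapping.single (u, counit) 1
      + Poly_Mapping.single (counit, counit) (- u 1) + (\<Sum>i\<in>F. Poly_Mapping.single (v i, w i) 1))"
    by (rule exists_dist_comult[OF u]) blast
  have "act u (a * b) = a * act u b + act u a * b - scaleA (u 1) (a * b)
      + (\<Sum>i\<in>F. act (v i) a * act (w i) b)" for a b
    unfolding act_product[OF subsetD[OF Dist_order_subset u] t]
    by (simp add: M.linear_extension_add M.linear_extension_sum act_unit)
  then show ?thesis by (intro that[of F v w] F(2)) blast
qed

text \<open>Only the generator is tested; \<open>dvd_act_mult\<close> shows that this gives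
  stability of the whole ideal under \<open>Dist_order n\<close>.\<close>

definition stable_upto :: "nat \<Rightarrow> 'a \<Rightarrow> bool" where
  "stable_upto n a \<longleftrightarrow> (\<forall>u\<in>Dist_order n. a dvd act u a)"

lemma stable_upto_0: "stable_upto 0 a"
  unfolding stable_upto_def by (auto dest!: Dist_order_0 simp: act_zero)

lemma stable_upto_Suc: "stable_upto (Suc n) a \<Longrightarrow> stable_upto n a"
  unfolding stable_upto_def using Dist_order_Suc[of n] by blast

lemma dvd_act_mult:
  assumes a: "stable_upto n a" and u: "u \<in> Dist_order n"
  shows "a dvd act u (a * b)"
proof (cases n)
  case 0
  then show ?thesis using u Dist_order_0[of u] act_zero by simp
next
  case (Suc m)
  obtain F :: "'h set" and v w where F: "\<forall>i\<in>F. v i \<in> Dist_order m \<and> w i \<in> Dist_order m"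
    "\<forall>a b. act u (a * b) = a * act u b + act u a * b - scaleA (u 1) (a * b)
      + (\<Sum>i\<in>F. act (v i) a * act (w i) b)"
    by (rule act_mult_expansion[OF u[unfolded Suc]])
  have "a dvd act u a" using a u by (simp add: stable_upto_def)
  moreover have "a dvd (\<Sum>i\<in>F. act (v i) a * act (w i) b)"
  proof (rule dvd_sum)
    fix i assume "i \<in> F"
    then have "a dvd act (v i) a"
      using F(1) stable_upto_Suc a[unfolded Suc] by (simp add: stable_upto_def)
    then show "a dvd act (v i) a * act (w i) b" by (rule dvd_mult2)
  qed
  ultimately show ?thesis
    unfolding F(2)[rule_format] by (intro dvd_add dvd_diff dvd_scaleA dvd_mult2 dvd_triv_left dvd_refl)
qed

lemma stable_upto_mult:
  assumes "stable_upto n a" "stable_upto n b"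
  shows "stable_upto n (a * b)"
  unfolding stable_upto_def
proof
  fix u assume u: "u \<in> Dist_order n"
  show "a * b dvd act u (a * b)"
  proof (cases n)
    case 0
    then show ?thesis using u Dist_order_0[of u] act_zero by simp
  next
    case (Suc m)
    obtain F :: "'h set" and v w where F: "\<forall>i\<in>F. v i \<in> Dist_order m \<and> w i \<in> Dist_order m"
      "\<forall>a b. act u (a * b) = a * act u b + act u a * b - scaleA (u 1) (a * b)
        + (\<Sum>i\<in>F. act (v i) a * act (w i) b)"
      by (rule act_mult_expansion[OF u[unfolded Suc]])
    have "a dvd act u a" "b dvd act u b" using assms u by (simp_all add: stable_upto_def)
    moreover have "a * b dvd (\<Sum>i\<in>F. act (v i) a * act (w i) b)"
    proof (rule dvd_sum)
      fix i assume "i \<in> F"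
      then have "a dvd act (v i) a" "b dvd act (w i) b"
        using F(1) stable_upto_Suc assms[unfolded Suc] by (simp_all add: stable_upto_def)
      then show "a * b dvd act (v i) a * act (w i) b" by (rule mult_dvd_mono)
    qed
    ultimately show ?thesis
      unfolding F(2)[rule_format]
      by (intro dvd_add dvd_diff dvd_scaleA mult_dvd_mono dvd_refl)
  qed
qed

lemma stable_upto_1: "stable_upto n 1"
  by (simp add: stable_upto_def)

lemma stable_upto_power: "stable_upto n a \<Longrightarrow> stable_upto n (a ^ m)"
  by (induction m) (simp_all add: stable_upto_1 stable_upto_mult)

text \<open>Stability of a and b is assumed for one index less than that of u; this gap drives the
  inductions on the index.\<close>

lemma dvd_leibniz:
  assumes a: "stable_upto n a" and b: "stable_upto n b" and u: "u \<in> Dist_order (Suc n)"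
  shows "a * b dvd act u (a * b) - (a * act u b + b * act u a)"
proof -
  obtain F :: "'h set" and v w where F: "\<forall>i\<in>F. v i \<in> Dist_order n \<and> w i \<in> Dist_order n"
    "\<forall>a b. act u (a * b) = a * act u b + act u a * b - scaleA (u 1) (a * b)
      + (\<Sum>i\<in>F. act (v i) a * act (w i) b)"
    by (rule act_mult_expansion[OF u])
  have "a * b dvd (\<Sum>i\<in>F. act (v i) a * act (w i) b)"
  proof (rule dvd_sum)
    fix i assume "i \<in> F"
    then have "a dvd act (v i) a" "b dvd act (w i) b"
      using F(1) a b by (simp_all add: stable_upto_def)
    then show "a * b dvd act (v i) a * act (w i) b" by (rule mult_dvd_mono)
  qed
  then have "a * b dvd (\<Sum>i\<in>F. act (v i) a * act (w i) b) - scaleA (u 1) (a * b)"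
    by (intro dvd_diff dvd_scaleA dvd_refl)
  also have "(\<Sum>i\<in>F. act (v i) a * act (w i) b) - scaleA (u 1) (a * b)
      = act u (a * b) - (a * act u b + b * act u a)"
    unfolding F(2)[rule_format] by (simp add: mult.commute)
  finally show ?thesis .
qed

text \<open>Modulo a b, the term a u(b) is u(a b) - b u(a). Both of these are divisible by a b, and
  a can be cancelled.\<close>

lemma stable_upto_quotient:
  assumes "a \<noteq> 0" "\<And>n. stable_upto n a" "\<And>n. stable_upto n (a * b)"
  shows "stable_upto n b"
proof (induction n)
  case 0
  show ?case by (rule stable_upto_0)
next
  case (Suc n)
  show ?case
    unfolding stable_upto_def
  proof
    fix u assume u: "u \<in> Dist_order (Suc n)"
    have 1: "a * b dvd act u (a * b) - (a * act u b + b * act u a)"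
      by (rule dvd_leibniz[OF assms(2) Suc u])
    have 2: "a * b dvd act u (a * b)" using assms(3) u by (simp add: stable_upto_def)
    have "a * b dvd b * act u a"
      using assms(2)[of "Suc n"] u mult_dvd_mono[of b b a "act u a"]
      by (simp add: stable_upto_def mult.commute)
    with dvd_diff[OF 2 1] have "a * b dvd act u (a * b)
        - (act u (a * b) - (a * act u b + b * act u a)) - b * act u a"
      by (rule dvd_diff)
    then have "a * b dvd a * act u b" by simp
    then show "b dvd act u b" using assms(1) by simp
  qed
qed

text \<open>The product b c divides b u(c) + c u(b), so b divides c u(b) and c divides b u(c).
  Coprimality is expressed as the cancellation that this calls for. Both factors go through the
  induction together because \<open>dvd_leibniz\<close> takes both as stable.\<close>

lemma stable_upto_coprime_factors:
  assumes "\<And>x. b dvd c * x \<Longrightarrow> b dvd x" "\<And>x. c dvd b * x \<Longrightarrow> c dvd x"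
    and bc: "\<And>n. stable_upto n (b * c)"
  shows "stable_upto n b \<and> stable_upto n c"
proof (induction n)
  case 0
  show ?case by (simp add: stable_upto_0)
next
  case (Suc n)
  then have IH: "stable_upto n b" "stable_upto n c" by simp_all
  have "b dvd act u b \<and> c dvd act u c" if u: "u \<in> Dist_order (Suc n)" for u
  proof -
    have 1: "b * c dvd act u (b * c) - (b * act u c + c * act u b)"
      by (rule dvd_leibniz[OF IH u])
    have 2: "b * c dvd act u (b * c)" using bc u by (simp add: stable_upto_def)
    have 3: "b * c dvd b * act u c + c * act u b" using dvd_diff[OF 2 1] by simp
    have "b dvd (b * act u c + c * act u b) - b * act u c"
      by (rule dvd_diff[OF dvd_mult_left[OF 3] dvd_triv_left])
    then have "b dvd c * act u b" by (simp only: add_diff_cancel_left')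
    then have "b dvd act u b" by (rule assms(1))
    moreover have "c dvd (b * act u c + c * act u b) - c * act u b"
      by (rule dvd_diff[OF dvd_mult_right[OF 3] dvd_triv_left])
    then have "c dvd b * act u c" by (simp only: add_diff_cancel_right')
    then have "c dvd act u c" by (rule assms(2))
    ultimately show ?thesis by blast
  qed
  then show ?case by (simp add: stable_upto_def)
qed

lemma dvd_act_power:
  assumes b: "stable_upto n b" and u: "u \<in> Dist_order (Suc n)"
  shows "b ^ Suc m dvd act u (b ^ Suc m) - of_nat (Suc m) * b ^ m * act u b"
proof (induction m)
  case 0
  show ?case by simp
next
  case (Suc m)
  have "b ^ Suc (Suc m) dvd act u (b ^ Suc (Suc m)) - (b * act u (b ^ Suc m) + b ^ Suc m * act u b)"
    using dvd_leibniz[OF b stable_upto_power[OF b] u, of "Suc m"] by (simp only: power_Suc)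
  moreover have "b ^ Suc (Suc m) dvd b * (act u (b ^ Suc m) - of_nat (Suc m) * b ^ m * act u b)"
    using mult_dvd_mono[OF dvd_refl Suc.IH, of b] by (simp only: power_Suc)
  ultimately have "b ^ Suc (Suc m) dvd
      (act u (b ^ Suc (Suc m)) - (b * act u (b ^ Suc m) + b ^ Suc m * act u b))
      + b * (act u (b ^ Suc m) - of_nat (Suc m) * b ^ m * act u b)"
    by (rule dvd_add)
  also have "(act u (b ^ Suc (Suc m)) - (b * act u (b ^ Suc m) + b ^ Suc m * act u b))
      + b * (act u (b ^ Suc m) - of_nat (Suc m) * b ^ m * act u b)
      = act u (b ^ Suc (Suc m)) - of_nat (Suc (Suc m)) * b ^ Suc m * act u b"
  proof -
    have "(X - (b * Y + b * p * U)) + b * (Y - N * p * U) = X - (1 + N) * (b * p) * U" for X Y U N p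
      by (simp add: algebra_simps)
    then show ?thesis by (simp only: power_Suc of_nat_Suc)
  qed
  finally show ?case .
qed

lemma of_nat_dvd_cancel:
  assumes m: "of_nat m \<noteq> (0 :: 'k)" and d: "b dvd of_nat m * y"
  shows "b dvd (y :: 'a)"
proof -
  have "scaleA (of_nat k) y = of_nat k * y" for k
    by (induction k) (simp_all add: M.scale_left_distrib distrib_right)
  then have "b dvd scaleA (of_nat m) y" using d by simp
  then have "b dvd scaleA (inverse (of_nat m)) (scaleA (of_nat m) y)"
    by (rule dvd_scaleA)
  then show ?thesis using m by simp
qed

text \<open>By \<open>dvd_act_power\<close>, b^m divides m b^(m-1) u(b); cancel b^(m-1) and the
  invertible m.\<close>

lemma stable_upto_root:
  assumes b: "b \<noteq> 0" and m: "of_nat m \<noteq> (0 :: 'k)" and power: "\<And>n. stable_upto n (b ^ m)"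
  shows "stable_upto n b"
proof (induction n)
  case 0
  show ?case by (rule stable_upto_0)
next
  case (Suc n)
  obtain k where k: "m = Suc k" using m by (cases m) auto
  show ?case
    unfolding stable_upto_def
  proof
    fix u assume u: "u \<in> Dist_order (Suc n)"
    have 2: "b ^ Suc k dvd act u (b ^ Suc k)"
      using power u unfolding k stable_upto_def by blast
    have "b ^ Suc k dvd of_nat m * b ^ k * act u b"
      using dvd_diff[OF 2 dvd_act_power[OF Suc u, of k]] by (simp add: k)
    then have "b ^ k * b dvd b ^ k * (of_nat m * act u b)" by (simp add: mult_ac)
    then have "b dvd of_nat m * act u b" using b by (subst (asm) dvd_mult_cancel_left) simp
    then show "b dvd act u b" by (rule of_nat_dvd_cancel[OF m])
  qed
qed

lemma stable_under_Dist_iff: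
  "stable_under (Dist scale counit) act (principal_ideal a) \<longleftrightarrow> (\<forall>n. stable_upto n a)"
proof
  assume L: "stable_under (Dist scale counit) act (principal_ideal a)"
  have "a \<in> principal_ideal a" unfolding principal_ideal_def by (rule image_eqI[of _ _ 1]) simp_all
  then have "act u a \<in> principal_ideal a" if "u \<in> Dist_order n" for u n
    using L that Dist_order_subset unfolding stable_under_def by blast
  moreover have "a dvd y" if "y \<in> principal_ideal a" for y
    using that by (auto simp: principal_ideal_def)
  ultimately show "\<forall>n. stable_upto n a"
    by (simp add: stable_upto_def)
next
  assume R: "\<forall>n. stable_upto n a"
  show "stable_under (Dist scale counit) act (principal_ideal a)"
    unfolding stable_under_def
  proof (intro ballI)
    fix u x assume "u \<in> Dist scale counit" "x \<in> principal_ideal a"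
    then obtain n c where u: "u \<in> Dist_order n" and x: "x = a * c"
      unfolding Dist_eq principal_ideal_def by (auto simp: mult.commute)
    have "a dvd act u x" unfolding x using R u by (intro dvd_act_mult) simp_all
    then obtain d where "act u x = a * d" by (rule dvdE)
    then show "act u x \<in> principal_ideal a"
      unfolding principal_ideal_def by (intro image_eqI[of _ _ d]) (simp_all add: mult.commute)
  qed
qed

lemma act_sum:
  assumes "finite F" "\<forall>i\<in>F. v i \<in> Dist_order n"
  shows "(\<lambda>f. \<Sum>i\<in>F. v i f) \<in> Dist_order n \<and> act (\<lambda>f. \<Sum>i\<in>F. v i f) a = (\<Sum>i\<in>F. act (v i) a)"
  using assms
proof (induction F rule: finite_induct)
  case empty
  show ?case by (simp add: act_zero Dist_order_def linear_functional_iff)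
next
  case (insert i F)
  have v: "v i \<in> Dist_order n" "(\<lambda>f. \<Sum>i\<in>F. v i f) \<in> Dist_order n" using insert by auto
  then have "(\<lambda>f. v i f + (\<Sum>i\<in>F. v i f)) \<in> Dist_order n"
    by (simp add: Dist_order_def linear_functional_iff distrib_left)
  moreover have "act (\<lambda>f. v i f + (\<Sum>i\<in>F. v i f)) a = act (v i) a + act (\<lambda>f. \<Sum>i\<in>F. v i f) a"
    using v Dist_order_subset by (intro act_add) blast+
  ultimately show ?case using insert by simp
qed

text \<open>The induction hypothesis serves twice: for \<open>w\<close>, which lies one step lower,
  and for the left factors \<open>u' f\<close> of the products that make up \<open>E\<close>. The
  characteristic enters only through the division by n.\<close>

lemma Lie_stable_imp_stable_upto:
  assumes char: "CHAR('k) = 0" and a: "\<And>x. x \<in> Lie scale counit \<Longrightarrow> a dvd act x a"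
  shows "stable_upto n a"
proof (induction n)
  case 0
  show ?case by (rule stable_upto_0)
next
  case (Suc n)
  show ?case
    unfolding stable_upto_def
  proof
    fix u assume u: "u \<in> Dist_order (Suc n)"
    have lin: "Vector_Spaces.linear scale (*) u" using u by (simp add: Dist_order_def)
    show "a dvd act u a"
    proof (cases n)
      \<comment> \<open>Division by n is impossible here, but k[H] = k 1 + I shows that u is a
        multiple of \<open>counit\<close>.\<close>
      case 0
      have "u g = u 1 * counit g" for g
      proof -
        have "u (reduced g) = 0"
          using u reduced_mem_aug[of g] unfolding 0 Dist_order_def ideal_power_1[OF is_ideal_aug]
          by blast
        then show ?thesis by (simp add: reduced_def linear_functional_simps[OF lin] mult.commute)
      qed
      then have "u = (\<lambda>g. u 1 * counit g)" by (rule ext)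
      then have "act u a = act (\<lambda>g. u 1 * counit g) a" by (rule arg_cong)
      also have "\<dots> = scaleA (u 1) a"
        using counit_mem_Dist_order Dist_order_subset by (subst act_scale) (auto simp: act_unit)
      finally show ?thesis by (simp add: dvd_scaleA)
    next
      case n: (Suc m)
      obtain F x where F: "finite F" "F \<subseteq> aug"
        and x': "\<forall>f\<in>F. Vector_Spaces.linear scale (*) (x f) \<and> x f 1 = 0 \<and> (\<forall>g\<in>ideal_power aug 2. x f g = 0)"
        and dual: "\<forall>g\<in>aug. g - (\<Sum>f\<in>F. scale (x f g) f) \<in> ideal_power aug 2"
        by (rule dual_family[of 2])
      have x: "x f \<in> Lie scale counit" if "f \<in> F" for f
        using x' that by (simp add: Lie_def)
      have lin_x: "Vector_Spaces.linear scale (*) (x f)" if "f \<in> F" for f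
        using x' that by blast
      define u' where "u' f = (\<lambda>g. u (f * g))" for f
      have u': "u' f \<in> Dist_order n" if "f \<in> F" for f
        unfolding u'_def using that F(2) by (intro Dist_order_translate[OF u]) blast
      define v where "v f = dist_mult comult (u' f) (x f)" for f
      have v_eq: "v f g = u (f * left_invariant_map (x f) g)" if f: "f \<in> F" for f g
        using functional_left_invariant_map[OF lin_x[OF f], of "u' f" g] u'[OF f]
        by (simp add: v_def u'_def Dist_order_def)
      \<comment> \<open>The derivation maps I^(n+1) into I^n, and multiplication by f leads back
        into I^(n+1). So all \<open>v f\<close> lie in one step of the filtration, as
        \<open>act_sum\<close> requires.\<close>
      have v: "v f \<in> Dist_order (Suc n)" if f: "f \<in> F" for f
      proof -
        have "Vector_Spaces.linear scale (*) (v f)"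
          by (simp add: linear_functional_iff v_eq[OF f] left_invariant_map_add[OF lin_x[OF f]]
              left_invariant_map_scale[OF lin_x[OF f]] distrib_left scale_mult_right
              linear_functional_simps[OF lin])
        moreover have "v f g = 0" if g: "g \<in> ideal_power aug (Suc n)" for g
        proof -
          have "f * left_invariant_map (x f) g \<in> ideal_power aug (Suc n)"
            using f F(2) left_invariant_map_aug_power[OF x[OF f] g]
            by (intro mult_mem_ideal_power_Suc) blast+
          then show ?thesis
            using u by (simp add: v_eq[OF f] Dist_order_def del: ideal_power.simps)
        qed
        ultimately show ?thesis by (simp add: Dist_order_def)
      qed
      define E where "E = (\<lambda>g. \<Sum>f\<in>F. v f g)"
      have E: "E \<in> Dist_order (Suc n)" "act E a = (\<Sum>f\<in>F. act (v f) a)"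
        unfolding E_def using act_sum[OF F(1), of v "Suc n" a] v by blast+
      have E_eq: "E g = u (euler_map F x g)" for g
        by (simp add: E_def euler_map_def linear_functional_simps[OF lin] v_eq)
      have n0: "of_nat n \<noteq> (0 :: 'k)"
        using char n by (simp add: of_nat_eq_0_iff_char_dvd del: of_nat_Suc)
      \<comment> \<open>The difference is written with a sum and scalar multiples, the operations
        covered by \<open>act_add\<close> and \<open>act_scale\<close>.\<close>
      define w where "w = (\<lambda>g. of_nat n * u g + (- 1) * E g)"
      have "w \<in> Dist_order n"
      proof -
        have "w g = 0" if g: "g \<in> ideal_power aug n" for g
        proof -
          have "euler_map F x g - of_nat n * g \<in> ideal_power aug (Suc n)"
            by (rule euler_map_aug_power[OF F(2) x dual[rule_format] g])
          then have "u (euler_map F x g - of_nat n * g) = 0"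
            using u by (simp add: Dist_order_def del: ideal_power.simps)
          moreover have "u (of_nat k * g) = of_nat k * u g" for k
            by (induction k) (simp_all add: distrib_right linear_functional_simps[OF lin])
          ultimately show ?thesis
            by (simp add: w_def E_eq linear_functional_simps[OF lin])
        qed
        moreover have "Vector_Spaces.linear scale (*) w"
          using E(1) lin by (simp add: w_def Dist_order_def linear_functional_iff algebra_simps)
        ultimately show ?thesis by (simp add: Dist_order_def)
      qed
      then have "a dvd act w a" using Suc.IH by (simp add: stable_upto_def)
      have "a dvd act E a"
        unfolding E(2)
      proof (rule dvd_sum)
        fix f assume f: "f \<in> F"
        have "x f \<in> Dist scale counit"
          using x[OF f] Dist_order_subset unfolding Lie_eq by blast
        then have "act (v f) a = act (u' f) (act (x f) a)"
          unfolding v_def using u'[OF f] Dist_order_subset by (intro act_mult) blast+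
        moreover obtain c where "act (x f) a = a * c" using a[OF x[OF f]] by (rule dvdE)
        ultimately show "a dvd act (v f) a"
          using dvd_act_mult[OF Suc.IH u'[OF f], of c] by simp
      qed
      have "act w a = scaleA (of_nat n) (act u a) - act E a"
      proof -
        have *: "(\<lambda>g. c * y g) \<in> Dist scale counit" if "y \<in> Dist_order (Suc n)" for c y
          using that Dist_order_subset[of "Suc n"]
          by (intro subsetD[OF Dist_order_subset[of "Suc n"]])
            (simp add: Dist_order_def linear_functional_iff algebra_simps)
        have "act w a = act (\<lambda>g. of_nat n * u g) a + act (\<lambda>g. (- 1) * E g) a"
          unfolding w_def by (intro act_add * u E(1))
        also have "\<dots> = scaleA (of_nat n) (act u a) + scaleA (- 1) (act E a)"
          using u E(1) Dist_order_subset[of "Suc n"] by (simp only: act_scale[OF subsetD])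
        finally show ?thesis by simp
      qed
      then have "act w a + act E a = scaleA (of_nat n) (act u a)" by simp
      then have "a dvd scaleA (of_nat n) (act u a)"
        using dvd_add[OF \<open>a dvd act w a\<close> \<open>a dvd act E a\<close>] by simp
      then have "a dvd scaleA (inverse (of_nat n)) (scaleA (of_nat n) (act u a))"
        by (rule dvd_scaleA)
      then show ?thesis using n0 by simp
    qed
  qed
qed

end

section \<open>Coprimality of a prime power and its cofactor\<close>

lemma prime_power_dvd_cancel:
  assumes q: "prime_elem (q :: 'a::idom)" "\<not> q dvd y"
  shows "q ^ n dvd y * x \<Longrightarrow> q ^ n dvd x"
proof (induction n arbitrary: x)
  case 0
  show ?case by simp
next
  case (Suc n)
  have q0: "q \<noteq> 0" using q by auto
  have "q dvd q ^ Suc n" by simp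
  then have "q dvd y * x" using Suc.prems by (rule dvd_trans)
  then have "q dvd x" using q prime_elem_dvd_mult_iff by blast
  then obtain z where z: "x = q * z" by (rule dvdE)
  have "q * q ^ n dvd q * (y * z)" using Suc.prems by (simp add: z mult.left_commute)
  then have "q ^ n dvd y * z" using q0 by (subst (asm) dvd_mult_cancel_left) simp
  then have "q ^ n dvd z" by (rule Suc.IH)
  then show ?case unfolding z by (simp add: mult_dvd_mono)
qed

text \<open>If q^n x = y z, then q^n divides z by \<open>prime_power_dvd_cancel\<close> and can be
  cancelled.\<close>

lemma dvd_prime_power_cancel:
  assumes q: "prime_elem (q :: 'a::idom)" "\<not> q dvd y" and d: "y dvd q ^ n * x"
  shows "y dvd x"
proof -
  obtain z where z: "q ^ n * x = y * z" using d by (rule dvdE)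
  have "q ^ n dvd y * z" unfolding z[symmetric] by simp
  then have "q ^ n dvd z" by (rule prime_power_dvd_cancel[OF q])
  then obtain w where "z = q ^ n * w" by (rule dvdE)
  then have "q ^ n * x = q ^ n * (y * w)" using z by (simp add: mult.left_commute)
  then have "x = y * w" using q(1) by simp
  then show ?thesis by simp
qed

lemma irreducible_unit_mult:
  assumes u: "u dvd (1 :: 'a::idom)" and q: "Factorial_Ring.irreducible q"
  shows "Factorial_Ring.irreducible (u * q)"
proof -
  obtain v where v: "1 = u * v" using u by (rule dvdE)
  then have vu: "v * u = 1" by (simp add: mult.commute)
  show ?thesis
    unfolding Factorial_Ring.irreducible_def
  proof (intro conjI allI impI notI)
    assume "u * q = 0"
    then show False using u q by (auto simp: Factorial_Ring.irreducible_def)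
  next
    assume "u * q dvd 1"
    then have "q dvd 1" by (rule dvd_mult_right)
    then show False using q by (simp add: Factorial_Ring.irreducible_def)
  next
    fix a b assume ab: "u * q = a * b"
    have "q = (v * u) * q" by (simp add: vu)
    also have "\<dots> = (v * a) * b" using ab by (simp only: mult.assoc)
    finally have "v * a dvd 1 \<or> b dvd 1"
      using q unfolding Factorial_Ring.irreducible_def by blast
    then show "a dvd 1 \<or> b dvd 1" using dvd_mult_right[of v a 1] by blast
  qed
qed

section \<open>The monoid of stable elements and its irreducible elements\<close>

context Dist_domain
begin

abbreviation "Dist_stable \<equiv> stable_elements (Dist scale counit) act"

lemma Dist_stable_iff: "a \<in> Dist_stable \<longleftrightarrow> a \<noteq> 0 \<and> (\<forall>n. stable_upto n a)"
  by (simp add: stable_elements_def stable_under_Dist_iff)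

lemma factorial_quotient_closed_Dist_stable:
  assumes "factorial_monoid (multiplicative_monoid (UNIV - {0 :: 'a}))"
  shows "factorial_quotient_closed_submonoid Dist_stable"
proof (intro factorial_quotient_closed_submonoid.intro quotient_closed_submonoid.intro
    factorial_quotient_closed_submonoid_axioms.intro assms)
  show "0 \<notin> Dist_stable" by (simp add: Dist_stable_iff)
  show "u \<in> Dist_stable" if "u dvd 1" for u
  proof -
    have "u \<noteq> 0" using that by auto
    moreover have "u dvd x" for x using that one_dvd by (rule dvd_trans)
    ultimately show ?thesis by (simp add: Dist_stable_iff stable_upto_def)
  qed
  show "x * y \<in> Dist_stable" if "x \<in> Dist_stable" "y \<in> Dist_stable" for x y
    using that by (simp add: Dist_stable_iff stable_upto_mult)
  show "y \<in> Dist_stable" if "x \<in> Dist_stable" "x * y \<in> Dist_stable" for x y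
    using that stable_upto_quotient[of x y] by (simp add: Dist_stable_iff)
  show "q ^ n \<in> Dist_stable" if "prime_elem q" "\<not> q dvd y" "q ^ n * y \<in> Dist_stable" for q y n
  proof -
    have "stable_upto k (q ^ n) \<and> stable_upto k y" for k
    proof (rule stable_upto_coprime_factors)
      show "q ^ n dvd x" if "q ^ n dvd y * x" for x
        using \<open>prime_elem q\<close> \<open>\<not> q dvd y\<close> that by (rule prime_power_dvd_cancel)
      show "y dvd x" if "y dvd q ^ n * x" for x
        using \<open>prime_elem q\<close> \<open>\<not> q dvd y\<close> that by (rule dvd_prime_power_cancel)
    qed (use that(3) in \<open>simp add: Dist_stable_iff\<close>)
    then show ?thesis using that(1) by (simp add: Dist_stable_iff)
  qed
qed

lemma Dist_stable_root:
  assumes "of_nat m \<noteq> (0 :: 'k)" "b ^ m \<in> Dist_stable"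
  shows "b \<in> Dist_stable"
proof -
  have "m \<noteq> 0" using assms(1) by (cases m) auto
  then have "b \<noteq> 0" using assms(2) by (auto simp: Dist_stable_iff)
  with stable_upto_root[OF _ assms(1)] assms(2) show ?thesis by (simp add: Dist_stable_iff)
qed

text \<open>The part k of m prime to p is invertible in the field, so the k-th root of
  \<open>q ^ m\<close> is again stable.\<close>

lemma Dist_stable_char_power:
  assumes p: "p = CHAR('k)" "p > 0" and m: "m > 0" "q ^ m \<in> Dist_stable"
  obtains s k where "m = p ^ s * k" "q ^ (p ^ s) \<in> Dist_stable"
proof -
  \<comment> \<open>A field does not have characteristic 1, so the multiplicity of \<open>p\<close>
    in \<open>m\<close> is finite.\<close>
  have "\<not> p dvd 1" using p by simp
  then obtain k where k: "m = p ^ multiplicity p m * k" "\<not> p dvd k"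
    using multiplicity_decompose'[of m p] m(1) by auto
  have "of_nat k \<noteq> (0 :: 'k)" using k(2) p(1) by (simp add: of_nat_eq_0_iff_char_dvd)
  moreover have "(q ^ (p ^ multiplicity p m)) ^ k \<in> Dist_stable"
    using m(2) k(1) by (simp flip: power_mult)
  ultimately have "q ^ (p ^ multiplicity p m) \<in> Dist_stable" by (rule Dist_stable_root)
  with k(1) show ?thesis by (rule that)
qed

lemma Dist_stable_irreducible_iff:
  "Factorial_Ring.irreducible q \<Longrightarrow>
    stable_under (Dist scale counit) act (principal_ideal (q ^ n)) \<longleftrightarrow> q ^ n \<in> Dist_stable"
  by (auto simp: stable_elements_def Factorial_Ring.irreducible_def)

text \<open>Every positive exponent is invertible in k, so the minimal exponent is 1, and the unit
  is absorbed since associates of irreducible elements are irreducible.\<close>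

lemma primary_elements_char_0:
  assumes "factorial_monoid (multiplicative_monoid (UNIV - {0 :: 'a}))" and char: "CHAR('k) = 0"
  shows "factorial_quotient_closed_submonoid.primary_elements Dist_stable =
    {a. Factorial_Ring.irreducible a \<and> stable_under (Lie scale counit) act (principal_ideal a)}"
proof -
  interpret factorial_quotient_closed_submonoid Dist_stable
    by (rule factorial_quotient_closed_Dist_stable[OF assms(1)])
  show ?thesis
  proof (intro subset_antisym subsetI)
    fix a assume a: "a \<in> primary_elements"
    then obtain u q n where u: "u dvd 1" and q: "Factorial_Ring.irreducible q"
      and n: "n > 0" "q ^ n \<in> Dist_stable" "\<forall>m. 0 < m \<and> m < n \<longrightarrow> q ^ m \<notin> Dist_stable"
      and eq: "a = u * q ^ n"
      unfolding primary_elements_def by blast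
    have "of_nat n \<noteq> (0 :: 'k)" using n(1) char by (simp add: of_nat_eq_0_iff_char_dvd)
    then have "q ^ 1 \<in> Dist_stable" using Dist_stable_root n(2) by simp
    then have "\<not> 1 < n" using n(3) by blast
    then have "a = u * q" using eq n(1) by (simp add: le_Suc_eq not_less)
    then have "Factorial_Ring.irreducible a" using irreducible_unit_mult[OF u q] by simp
    moreover have "a \<in> Dist_stable" using a primary_elements_mem by blast
    moreover have "Lie scale counit \<subseteq> Dist scale counit"
      unfolding Lie_eq using Dist_order_subset by blast
    ultimately show "a \<in> {a. Factorial_Ring.irreducible a \<and>
        stable_under (Lie scale counit) act (principal_ideal a)}"
      by (auto simp: stable_elements_def stable_under_def)
  next
    fix a assume "a \<in> {a. Factorial_Ring.irreducible a \<and>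
        stable_under (Lie scale counit) act (principal_ideal a)}"
    then have irr: "Factorial_Ring.irreducible a"
      and L: "stable_under (Lie scale counit) act (principal_ideal a)" by auto
    have "a dvd act x a" if "x \<in> Lie scale counit" for x
    proof -
      have "a \<in> principal_ideal a"
        unfolding principal_ideal_def by (rule image_eqI[of _ _ 1]) simp_all
      then have "act x a \<in> principal_ideal a" using L that by (simp add: stable_under_def)
      then show ?thesis by (auto simp: principal_ideal_def)
    qed
    then have "stable_upto n a" for n by (rule Lie_stable_imp_stable_upto[OF char])
    then have "a ^ 1 \<in> Dist_stable"
      using irr by (simp add: Dist_stable_iff Factorial_Ring.irreducible_def)
    moreover have "a = 1 * a ^ 1" by simp
    moreover have "\<forall>m. 0 < m \<and> m < 1 \<longrightarrow> a ^ m \<notin> Dist_stable" by simp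
    ultimately show "a \<in> primary_elements"
      unfolding primary_elements_def using irr one_dvd zero_less_one by blast
  qed
qed

text \<open>The definition of \<open>primary_elements\<close> compares all positive exponents, the
  right-hand side only powers of p. Both minimality conditions agree because each stable exponent is
  divisible by a stable power of p.\<close>

lemma primary_elements_char_p:
  assumes "factorial_monoid (multiplicative_monoid (UNIV - {0 :: 'a}))"
    and p: "p = CHAR('k)" "p > 0"
  shows "factorial_quotient_closed_submonoid.primary_elements Dist_stable =
    {u * a ^ (p ^ s) | u a s. u dvd 1 \<and> Factorial_Ring.irreducible a
      \<and> stable_under (Dist scale counit) act (principal_ideal (a ^ (p ^ s)))
      \<and> (\<forall>t<s. \<not> stable_under (Dist scale counit) act (principal_ideal (a ^ (p ^ t))))}"
proof -
  interpret factorial_quotient_closed_submonoid Dist_stable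
    by (rule factorial_quotient_closed_Dist_stable[OF assms(1)])
  have "p \<noteq> 1" using p by simp
  then have p1: "1 < p" using p(2) by simp
  show ?thesis
  proof (intro subset_antisym subsetI)
    fix x assume "x \<in> primary_elements"
    then obtain u q n where u: "u dvd 1" and q: "Factorial_Ring.irreducible q"
      and n: "n > 0" "q ^ n \<in> Dist_stable" "\<forall>m. 0 < m \<and> m < n \<longrightarrow> q ^ m \<notin> Dist_stable"
      and x: "x = u * q ^ n"
      unfolding primary_elements_def by blast
    obtain s k where s: "n = p ^ s * k" "q ^ (p ^ s) \<in> Dist_stable"
      by (rule Dist_stable_char_power[OF p n(1,2)])
    \<comment> \<open>The divisor \<open>p ^ s\<close> of n is itself a stable exponent, so
      minimality of n gives equality.\<close>
    have "p ^ s \<le> n" using s(1) n(1) by (intro dvd_imp_le) simp_all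
    moreover have "\<not> p ^ s < n" using n(3) s(2) p(2) by auto
    ultimately have ns: "n = p ^ s" by simp
    have "\<forall>t<s. q ^ (p ^ t) \<notin> Dist_stable"
      using n(3) p(2) p1 unfolding ns by (simp add: power_strict_increasing)
    then have "stable_under (Dist scale counit) act (principal_ideal (q ^ (p ^ s)))"
      "\<forall>t<s. \<not> stable_under (Dist scale counit) act (principal_ideal (q ^ (p ^ t)))"
      unfolding Dist_stable_irreducible_iff[OF q] using s(2) by blast+
    with u q x ns show "x \<in> {u * a ^ (p ^ s) | u a s. u dvd 1 \<and> Factorial_Ring.irreducible a
      \<and> stable_under (Dist scale counit) act (principal_ideal (a ^ (p ^ s)))
      \<and> (\<forall>t<s. \<not> stable_under (Dist scale counit) act (principal_ideal (a ^ (p ^ t))))}"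
      by blast
  next
    fix x assume "x \<in> {u * a ^ (p ^ s) | u a s. u dvd 1 \<and> Factorial_Ring.irreducible a
      \<and> stable_under (Dist scale counit) act (principal_ideal (a ^ (p ^ s)))
      \<and> (\<forall>t<s. \<not> stable_under (Dist scale counit) act (principal_ideal (a ^ (p ^ t))))}"
    then obtain u q s where u: "u dvd 1" and q: "Factorial_Ring.irreducible q"
      and x: "x = u * q ^ (p ^ s)"
      and s': "stable_under (Dist scale counit) act (principal_ideal (q ^ (p ^ s)))"
        "\<forall>t<s. \<not> stable_under (Dist scale counit) act (principal_ideal (q ^ (p ^ t)))"
      by blast
    note s = s'[unfolded Dist_stable_irreducible_iff[OF q]]
    have "q ^ m \<notin> Dist_stable" if m: "0 < m" "m < p ^ s" for m
    proof
      assume "q ^ m \<in> Dist_stable"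
      then obtain t k where t: "m = p ^ t * k" "q ^ (p ^ t) \<in> Dist_stable"
        by (rule Dist_stable_char_power[OF p m(1)])
      have "p ^ t \<le> m" using t(1) m(1) by (intro dvd_imp_le) simp_all
      then have "p ^ t < p ^ s" using m(2) by simp
      then have "t < s" using p1 by (simp add: power_strict_increasing_iff)
      with s(2) t(2) show False by blast
    qed
    moreover have "p ^ s > 0" using p(2) by simp
    ultimately show "x \<in> primary_elements"
      unfolding primary_elements_def using u q x s(1) by blast
  qed
qed

end

text \<open>Irreducibility in the monoid is invariant under multiplication by units, whereas a unit
  need not be a \<open>p ^ s\<close>-th power; hence the factor \<open>u\<close> in positive
  characteristic.\<close>

theorem theorem1:
  fixes scaleH :: "'k::field \<Rightarrow> 'h::comm_ring_1 \<Rightarrow> 'h"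
    and comult :: "'h \<Rightarrow> ('h \<times> 'h \<Rightarrow>\<^sub>0 'k)"
    and counit :: "'h \<Rightarrow> 'k"
    and antipode :: "'h \<Rightarrow> 'h"
    and scaleA :: "'k \<Rightarrow> 'a::idom \<Rightarrow> 'a"
    and act :: "('h \<Rightarrow> 'k) \<Rightarrow> 'a \<Rightarrow> 'a"
  defines "D \<equiv> Dist scaleH counit"
    and "L \<equiv> Lie scaleH counit"
  defines "M \<equiv> multiplicative_monoid (stable_elements D act)"
  assumes H: "affine_algebraic_group_scheme scaleH comult counit antipode"
    and irreducible_H: "irreducible_spectrum TYPE('h)"
    and A: "Dist_algebra scaleH comult counit antipode scaleA act"
    and A_ufd: "factorial_monoid (multiplicative_monoid (UNIV - {0 :: 'a}))"
  shows "factorial_monoid M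
    \<and> (CHAR('k) = 0 \<longrightarrow>
         {a \<in> carrier M. Divisibility.irreducible M a} =
         {a. Factorial_Ring.irreducible a \<and> stable_under L act (principal_ideal a)})
    \<and> (\<forall>p. p = CHAR('k) \<and> p > 0 \<longrightarrow>
         {a \<in> carrier M. Divisibility.irreducible M a} =
         {u * a ^ (p ^ s) | u a s. u dvd 1 \<and> Factorial_Ring.irreducible a
            \<and> stable_under D act (principal_ideal (a ^ (p ^ s)))
            \<and> (\<forall>t<s. \<not> stable_under D act (principal_ideal (a ^ (p ^ t))))})"
proof -
  interpret Dist_domain scaleH comult counit antipode scaleA act
    by (rule Dist_domain.intro[OF A])
  interpret factorial_quotient_closed_submonoid Dist_stable
    by (rule factorial_quotient_closed_Dist_stable[OF A_ufd])
  have carrier: "carrier M = Dist_stable"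
    by (simp add: M_def D_def)
  have irr: "{a \<in> carrier M. Divisibility.irreducible M a} = primary_elements"
    unfolding carrier unfolding M_def D_def by (rule irreducible_elements_eq)
  show ?thesis
    unfolding irr
  proof (intro conjI impI allI)
    show "factorial_monoid M"
      unfolding M_def D_def by (rule factorial_submonoid)
    show "primary_elements =
        {a. Factorial_Ring.irreducible a \<and> stable_under L act (principal_ideal a)}"
      if "CHAR('k) = 0"
      unfolding L_def using A_ufd that by (rule primary_elements_char_0)
    show "primary_elements =
        {u * a ^ (p ^ s) | u a s. u dvd 1 \<and> Factorial_Ring.irreducible a
          \<and> stable_under D act (principal_ideal (a ^ (p ^ s)))
          \<and> (\<forall>t<s. \<not> stable_under D act (principal_ideal (a ^ (p ^ t))))}"
      if "p = CHAR('k) \<and> p > 0" for p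
      unfolding D_def using that by (intro primary_elements_char_p[OF A_ufd]) simp_all
  qed
qed

end
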